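(* Let $n\ge 2$, let $\overline{M}=(M_1,M_2,\dots)$ be a sequence of $n\times n$ integer matrices with non-zero determinants, and let $\sum_{\overline{M}}$ be the associated $n$-solenoid. If the flows $\phi$ and $\psi$ on $\sum_{\overline{M}}$ are topologically equivalent, then $\rho(\phi)=\rho(\psi)$, where $\rho$ denotes the rotation class.
   Context: **Flows.** A flow on a space $X$ is a continuous group action of $(\mathbf{R},+)$ on $X$. Flows $\phi$ on $X$ and $\psi$ on $Y$ are topologically equivalent if there is a homeomorphism $h:X\to Y$ taking orbits of $\phi$ onto orbits of $\psi$ so that the orientation of orbits is preserved; one then writes $h:\phi\overset{\text{top}}{\approx}\psi$. **Solenoids.** Let $\mathbf{T}^n=(\mathbf{R}/\mathbf{Z})^n$ with identity $e$, and let $\pi^n:\mathbf{R}^n\to\mathbf{T}^n$ be the quotient covering map. For a sequence $\overline{M}=(M_1,M_2,\dots)$ of $n\times n$ integer matrices with non-zero determinants, let $f_j^{j+1}:\mathbf{T}^n\to\mathbf{T}^n$ be the epimorphism represented by $M_j$, i.e. $f_j^{j+1}\circ\pi^n=\pi^n\circ M_j$. The $n$-solenoid is the inverse limit topological group $$\sum\nolimits_{\overline{M}}=\Big\{\langle x_j\rangle_{j=1}^\infty\in\prod_{j=1}^\infty\mathbf{T}^n \;\Big|\; f_j^{j+1}(x_{j+1})=x_j\text{ for all }j\in\mathbf{N}\Big\}.$$ Let $p_1:\sum_{\overline{M}}\to\mathbf{T}^n$ be the projection onto the first factor, and define $$\pi_{\overline{M}}:\mathbf{R}^n\to\sum\nolimits_{\overline{M}},\qquad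 \pi_{\overline{M}}(s)=\big(\pi^n(s),\pi^n(M_1^{-1}s),\pi^n(M_2^{-1}M_1^{-1}s),\dots\big).$$ **Covering space and compactification of perspective.** Let $E_{\overline{M}}=\mathbf{R}^n\times p_1^{-1}(e)$, with covering map $\Pi_{\overline{M}}:E_{\overline{M}}\to\sum_{\overline{M}}$, $\Pi_{\overline{M}}(s,x)=\pi_{\overline{M}}(s)+x$. Let $h_n:\mathbf{R}^n\to\{x\in\mathbf{R}^n:\|x\|<1\}$, $h_n(x)=x/\sqrt{1+\|x\|^2}$, and let $\overline{\mathbf{D}^n}=\{x\in\mathbf{R}^n:\|x\|\le1\}$. The space $\overline{\mathbf{D}^n}\times p_1^{-1}(e)$ is a compactification of $E_{\overline{M}}$ via $h_n\times\mathrm{id}$. The compactification of perspective of $E_{\overline{M}}$ is the quotient of $\overline{\mathbf{D}^n}\times p_1^{-1}(e)$ obtained by identifying, for each $s\in S^{n-1}=\{s:\|s\|=1\}$, all points $(s,x)$ with $x\in p_1^{-1}(e)$ to a single point. Its remainder (the complement of the image of $E_{\overline{M}}$) is identified with $S^{n-1}$ by $[(s,x)]\mapsto s$. **Points of perspective.** A point $x\in S^{n-1}$ is a point of perspective of a flow $\phi$ on $\sum_{\overline{M}}$ if and only if $\phi$ has an orbit which lifts (through $\Pi_{\overline{M}}$) to an orbit $\mathcal{O}:\mathbf{R}\to E_{\overline{M}}$ such that, in the compactification of perspective, $\mathcal{O}(t_i)\to x$ for some sequence of real numbers $t_i\to\infty$. **Rotation class.** Each topological group automorphism $\alpha\in Aut(\sum_{\overline{M}})$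 lifts to a linear automorphism of $\mathbf{R}^n$, represented by a matrix $A(\alpha)$ with $\pi_{\overline{M}}\circ A(\alpha)=\alpha\circ\pi_{\overline{M}}$. A linear automorphism $A$ of $\mathbf{R}^n$ induces $\widehat{A}:S^{n-1}\to S^{n-1}$, $\widehat{A}(x)=A(x)/\|A(x)\|$. For $X\subset S^{n-1}$ put $$\overline{M}(X)=\bigcup\big\{\widehat{A(\alpha)}(X)\;\big|\;\alpha\in Aut(\textstyle\sum_{\overline{M}})\big\}.$$ The rotation class of a flow $\phi$ on $\sum_{\overline{M}}$ is $\rho(\phi)=\overline{M}(\{\text{points of perspective of }\phi\})$. *)

theory Defs
  imports "HOL-Analysis.Analysis"
begin

section \<open>The topological group \<open>\<real>/\<int>\<close> and the torus\<close>

definition int_cong :: "real \<Rightarrow> real \<Rightarrow> bool"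
  where "int_cong x y \<longleftrightarrow> x - y \<in> \<int>"

lemma equivp_int_cong: "equivp int_cong"
proof (rule equivpI)
  show "reflp int_cong" by (simp add: reflp_def int_cong_def)
  show "symp int_cong"
    unfolding symp_def int_cong_def by (metis Ints_minus minus_diff_eq)
  show "transp int_cong"
    unfolding transp_def int_cong_def
    using Ints_add by fastforce
qed

quotient_type circle = real / int_cong
  morphisms rep_circle to_circle
  by (rule equivp_int_cong)

instantiation circle :: ab_group_add
begin

lift_definition zero_circle :: circle is "0" .

lift_definition plus_circle :: "circle \<Rightarrow> circle \<Rightarrow> circle" is "(+)"
  unfolding int_cong_def by (simp only: add_diff_add Ints_add)

lift_definition uminus_circle :: "circle \<Rightarrow> circle" is "uminus"
  unfolding int_cong_def by (simp only: minus_diff_minus Ints_minus)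

definition minus_circle :: "circle \<Rightarrow> circle \<Rightarrow> circle"
  where "minus_circle x y = x + - y"

instance
proof
  fix a b c :: circle
  show "a + b + c = a + (b + c)" by transfer (simp add: int_cong_def)
  show "a + b = b + a" by transfer (simp add: int_cong_def)
  show "0 + a = a" by transfer (simp add: int_cong_def)
  show "- a + a = 0" by transfer (simp add: int_cong_def)
  show "a - b = a + - b" by (rule minus_circle_def)
qed

end

instantiation circle :: topological_space
begin

text \<open>The quotient topology.\<close>

definition open_circle :: "circle set \<Rightarrow> bool"
  where "open_circle U \<longleftrightarrow> open (to_circle -` U)"

instance
proof
  show "open (UNIV :: circle set)" by (simp add: open_circle_def)
  show "open (S \<inter> T)" if "open S" "open T" for S T :: "circle set"
    using that by (simp add: open_circle_def open_Int)
  show "open (\<Union>K)" if "\<forall>S\<in>K. open S" for K :: "circle set set"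
    using that by (auto simp: open_circle_def vimage_Union)
qed

end

text \<open>\<open>\<int>\<close>-module structure of the circle.\<close>

lift_definition int_scale :: "int \<Rightarrow> circle \<Rightarrow> circle" is "\<lambda>k x. of_int k * x"
  unfolding int_cong_def by (simp only: right_diff_distrib[symmetric] Ints_mult Ints_of_int)

type_synonym 'n torus = "circle ^ 'n"

definition torus_proj :: "real ^ 'n \<Rightarrow> 'n torus"
  where "torus_proj s = (\<chi> i. to_circle (s $ i))"

definition torus_map :: "int ^ 'n ^ 'n \<Rightarrow> 'n torus \<Rightarrow> 'n torus"
  where "torus_map A x = (\<chi> i. \<Sum>j\<in>UNIV. int_scale (A $ i $ j) (x $ j))"

definition real_matrix :: "int ^ 'n ^ 'n \<Rightarrow> real ^ 'n ^ 'n"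
  where "real_matrix A = (\<chi> i j. of_int (A $ i $ j))"

lemma to_circle_sum: "to_circle (sum f I) = (\<Sum>i\<in>I. to_circle (f i))"
  by (induction I rule: infinite_finite_induct)
     (simp_all add: zero_circle.abs_eq plus_circle.abs_eq[symmetric])

lemma torus_map_torus_proj: "torus_map A (torus_proj s) = torus_proj (real_matrix A *v s)"
  by (simp add: torus_map_def torus_proj_def real_matrix_def matrix_vector_mult_def
      vec_eq_iff to_circle_sum int_scale.abs_eq)

lemma surj_torus_proj: "surj torus_proj"
proof (rule surjI)
  show "torus_proj (\<chi> i. rep_circle (x $ i)) = x" for x :: "circle ^ 'n"
    by (simp add: torus_proj_def vec_eq_iff Quotient3_abs_rep[OF Quotient3_circle])
qed


section \<open>Solenoids\<close>

text \<open>
  Sequences are indexed from \<open>0\<close>: \<open>M j\<close> is \<open>M\<^sub>j\<^sub>+\<^sub>1\<close> in the usual notation, and \<open>x 0\<close> is the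
  first coordinate of a point \<open>x\<close> of the solenoid.  The solenoid carries the subspace topology
  of the product topology on functions, and coordinatewise addition.
\<close>

definition solenoid :: "(nat \<Rightarrow> int ^ 'n ^ 'n) \<Rightarrow> (nat \<Rightarrow> 'n torus) set"
  where "solenoid M = {x. \<forall>j. torus_map (M j) (x (Suc j)) = x j}"

definition seq_add :: "(nat \<Rightarrow> 'n::finite torus) \<Rightarrow> (nat \<Rightarrow> 'n torus) \<Rightarrow> (nat \<Rightarrow> 'n torus)"
  where "seq_add x y = (\<lambda>j. x j + y j)"

primrec inv_iter :: "(nat \<Rightarrow> int ^ 'n ^ 'n) \<Rightarrow> nat \<Rightarrow> real ^ 'n \<Rightarrow> real ^ 'n"
  where
    "inv_iter M 0 s = s"
  | "inv_iter M (Suc j) s = matrix_inv (real_matrix (M j)) *v inv_iter M j s"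

definition solenoid_proj :: "(nat \<Rightarrow> int ^ 'n ^ 'n) \<Rightarrow> real ^ 'n \<Rightarrow> (nat \<Rightarrow> 'n torus)"
  where "solenoid_proj M s = (\<lambda>j. torus_proj (inv_iter M j s))"

definition fibre :: "(nat \<Rightarrow> int ^ 'n ^ 'n) \<Rightarrow> (nat \<Rightarrow> 'n torus) set"
  where "fibre M = {x \<in> solenoid M. x 0 = 0}"

definition cover :: "(nat \<Rightarrow> int ^ 'n ^ 'n) \<Rightarrow> (real ^ 'n) \<times> (nat \<Rightarrow> 'n torus) \<Rightarrow> (nat \<Rightarrow> 'n torus)"
  where "cover M p = seq_add (solenoid_proj M (fst p)) (snd p)"


section \<open>Flows and topological equivalence\<close>

definition flow_on :: "'a::topological_space set \<Rightarrow> (real \<Rightarrow> 'a \<Rightarrow> 'a) \<Rightarrow> bool"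
  where "flow_on X \<phi> \<longleftrightarrow>
    (\<forall>t. \<forall>x\<in>X. \<phi> t x \<in> X) \<and>
    (\<forall>x\<in>X. \<phi> 0 x = x) \<and>
    (\<forall>s t. \<forall>x\<in>X. \<phi> (s + t) x = \<phi> s (\<phi> t x)) \<and>
    continuous_on (UNIV \<times> X) (\<lambda>(t, x). \<phi> t x)"

definition orbit :: "(real \<Rightarrow> 'a \<Rightarrow> 'a) \<Rightarrow> 'a \<Rightarrow> 'a set"
  where "orbit \<phi> x = range (\<lambda>t. \<phi> t x)"

text \<open>
  Preservation of the orientation of an orbit means that \<open>h\<close> carries the parametrisation by
  \<open>\<phi>\<close> to the one by \<open>\<psi>\<close> up to an increasing homeomorphism of the time axis.
\<close>

definition orientation_preserving_at ::
    "(real \<Rightarrow> 'a \<Rightarrow> 'a) \<Rightarrow> (real \<Rightarrow> 'b \<Rightarrow> 'b) \<Rightarrow> ('a \<Rightarrow> 'b) \<Rightarrow> 'a \<Rightarrow> bool"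
  where "orientation_preserving_at \<phi> \<psi> h x \<longleftrightarrow>
    (\<exists>\<tau> \<tau>'. homeomorphism UNIV UNIV \<tau> \<tau>' \<and> strict_mono \<tau> \<and>
            (\<forall>t. h (\<phi> t x) = \<psi> (\<tau> t) (h x)))"

definition top_equivalent ::
    "'a::topological_space set \<Rightarrow> (real \<Rightarrow> 'a \<Rightarrow> 'a) \<Rightarrow>
     'b::topological_space set \<Rightarrow> (real \<Rightarrow> 'b \<Rightarrow> 'b) \<Rightarrow> bool"
  where "top_equivalent X \<phi> Y \<psi> \<longleftrightarrow>
    (\<exists>h h'. homeomorphism X Y h h' \<and>
      (\<forall>x\<in>X. h ` orbit \<phi> x = orbit \<psi> (h x) \<and> orientation_preserving_at \<phi> \<psi> h x))"


section \<open>The compactification of perspective\<close>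

definition perspective_class ::
    "(nat \<Rightarrow> int ^ 'n ^ 'n) \<Rightarrow> (real ^ 'n) \<times> (nat \<Rightarrow> 'n torus) \<Rightarrow>
     ((real ^ 'n) \<times> (nat \<Rightarrow> 'n torus)) set"
  where "perspective_class M p =
    {q \<in> cball 0 1 \<times> fibre M. q = p \<or> norm (fst p) = 1 \<and> fst q = fst p}"

text \<open>The set of classes, with the quotient topology.\<close>

definition perspective_compactification ::
    "(nat \<Rightarrow> int ^ 'n ^ 'n) \<Rightarrow> ((real ^ 'n) \<times> (nat \<Rightarrow> 'n torus)) set topology"
  where "perspective_compactification M = topology (\<lambda>U.
    U \<subseteq> perspective_class M ` (cball 0 1 \<times> fibre M) \<and>
    openin (top_of_set (cball 0 1 \<times> fibre M))
      {p \<in> cball 0 1 \<times> fibre M. perspective_class M p \<in> U})"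

lemma openin_perspective_compactification:
  "openin (perspective_compactification M) U \<longleftrightarrow>
    U \<subseteq> perspective_class M ` (cball 0 1 \<times> fibre M) \<and>
    openin (top_of_set (cball 0 1 \<times> fibre M))
      {p \<in> cball 0 1 \<times> fibre M. perspective_class M p \<in> U}"
proof -
  let ?D = "cball 0 1 \<times> fibre M" and ?q = "perspective_class M"
  have "istopology (\<lambda>U. U \<subseteq> ?q ` ?D \<and> openin (top_of_set ?D) {p \<in> ?D. ?q p \<in> U})"
    unfolding istopology_def
  proof (intro conjI allI impI)
    fix S T
    assume S: "S \<subseteq> ?q ` ?D \<and> openin (top_of_set ?D) {p \<in> ?D. ?q p \<in> S}"
      and T: "T \<subseteq> ?q ` ?D \<and> openin (top_of_set ?D) {p \<in> ?D. ?q p \<in> T}"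
    show "S \<inter> T \<subseteq> ?q ` ?D" using S by blast
    have "{p \<in> ?D. ?q p \<in> S \<inter> T} = {p \<in> ?D. ?q p \<in> S} \<inter> {p \<in> ?D. ?q p \<in> T}" by blast
    then show "openin (top_of_set ?D) {p \<in> ?D. ?q p \<in> S \<inter> T}"
      using S T by (simp only: openin_Int)
  next
    fix K
    assume K: "\<forall>S\<in>K. S \<subseteq> ?q ` ?D \<and> openin (top_of_set ?D) {p \<in> ?D. ?q p \<in> S}"
    show "\<Union>K \<subseteq> ?q ` ?D" using K by blast
    have "{p \<in> ?D. ?q p \<in> \<Union>K} = (\<Union>S\<in>K. {p \<in> ?D. ?q p \<in> S})" by blast
    moreover have "openin (top_of_set ?D) (\<Union>S\<in>K. {p \<in> ?D. ?q p \<in> S})"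
      using K by (intro openin_Union) auto
    ultimately show "openin (top_of_set ?D) {p \<in> ?D. ?q p \<in> \<Union>K}" by (rule ssubst)
  qed
  then show ?thesis
    unfolding perspective_compactification_def by (simp add: topology_inverse')
qed

definition ball_embed :: "real ^ 'n \<Rightarrow> real ^ 'n"
  where "ball_embed x = x /\<^sub>R sqrt (1 + (norm x)\<^sup>2)"

definition perspective_embed ::
    "(nat \<Rightarrow> int ^ 'n ^ 'n) \<Rightarrow> (real ^ 'n) \<times> (nat \<Rightarrow> 'n torus) \<Rightarrow>
     ((real ^ 'n) \<times> (nat \<Rightarrow> 'n torus)) set"
  where "perspective_embed M p = perspective_class M (ball_embed (fst p), snd p)"

text \<open>
  For \<open>norm s = 1\<close>, the point of the remainder corresponding to \<open>s\<close>; the second component of the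
  representative is immaterial (see below).
\<close>

definition remainder_point ::
    "(nat \<Rightarrow> int ^ 'n ^ 'n) \<Rightarrow> real ^ 'n \<Rightarrow> ((real ^ 'n) \<times> (nat \<Rightarrow> 'n torus)) set"
  where "remainder_point M s = perspective_class M (s, \<lambda>j. 0)"

lemma perspective_class_remainder:
  assumes "norm s = 1" "x \<in> fibre M"
  shows "perspective_class M (s, x) = remainder_point M s"
  using assms unfolding remainder_point_def perspective_class_def
  by (auto simp: fibre_def solenoid_def torus_map_def int_scale_def zero_circle_def vec_eq_iff)


section \<open>Points of perspective and the rotation class\<close>

definition points_of_perspective ::
    "(nat \<Rightarrow> int ^ 'n ^ 'n) \<Rightarrow> (real \<Rightarrow> (nat \<Rightarrow> 'n torus) \<Rightarrow> (nat \<Rightarrow> 'n torus)) \<Rightarrow> (real ^ 'n) set"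
  where "points_of_perspective M \<phi> = {x \<in> sphere 0 1.
    \<exists>y\<in>solenoid M. \<exists>L. continuous_on UNIV L \<and> range L \<subseteq> UNIV \<times> fibre M \<and>
      (\<forall>t. cover M (L t) = \<phi> t y) \<and>
      (\<exists>t. filterlim t at_top sequentially \<and>
        limitin (perspective_compactification M) (\<lambda>i. perspective_embed M (L (t i)))
          (remainder_point M x) sequentially)}"

definition solenoid_aut ::
    "(nat \<Rightarrow> int ^ 'n ^ 'n) \<Rightarrow> ((nat \<Rightarrow> 'n torus) \<Rightarrow> (nat \<Rightarrow> 'n torus)) set"
  where "solenoid_aut M = {\<alpha>.
    (\<exists>\<beta>. homeomorphism (solenoid M) (solenoid M) \<alpha> \<beta>) \<and>
    (\<forall>x\<in>solenoid M. \<forall>y\<in>solenoid M. \<alpha> (seq_add x y) = seq_add (\<alpha> x) (\<alpha> y))}"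

text \<open>
  A relation instead of a choice of \<open>A(\<alpha>)\<close>: for an automorphism \<open>\<alpha>\<close> of a solenoid there is exactly
  one such matrix \<open>A\<close>, so a union over pairs \<open>(\<alpha>, A)\<close> is a union over \<open>\<alpha>\<close>.
\<close>

definition lift_matrix ::
    "(nat \<Rightarrow> int ^ 'n ^ 'n) \<Rightarrow> ((nat \<Rightarrow> 'n torus) \<Rightarrow> (nat \<Rightarrow> 'n torus)) \<Rightarrow> real ^ 'n ^ 'n \<Rightarrow> bool"
  where "lift_matrix M \<alpha> A \<longleftrightarrow>
    invertible A \<and> (\<forall>s. solenoid_proj M (A *v s) = \<alpha> (solenoid_proj M s))"

definition sphere_map :: "real ^ 'n ^ 'n \<Rightarrow> real ^ 'n \<Rightarrow> real ^ 'n"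
  where "sphere_map A x = (A *v x) /\<^sub>R norm (A *v x)"

definition aut_saturation :: "(nat \<Rightarrow> int ^ 'n ^ 'n) \<Rightarrow> (real ^ 'n) set \<Rightarrow> (real ^ 'n) set"
  where "aut_saturation M X =
    \<Union>{sphere_map A ` X | \<alpha> A. \<alpha> \<in> solenoid_aut M \<and> lift_matrix M \<alpha> A}"

definition rotation_class ::
    "(nat \<Rightarrow> int ^ 'n ^ 'n) \<Rightarrow> (real \<Rightarrow> (nat \<Rightarrow> 'n torus) \<Rightarrow> (nat \<Rightarrow> 'n torus)) \<Rightarrow> (real ^ 'n) set"
  where "rotation_class M \<phi> = aut_saturation M (points_of_perspective M \<phi>)"

end

(*
  A homeomorphism h of the solenoid lifts, on each path component R^n x {c} of the covering space,
  to a map R^n -> R^n. By compactness each coordinate of h is determined up to a small error by a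
  single coordinate of its argument, so the lift is nearly periodic under a full lattice. Its
  increments along the lattice are therefore close to those of a homomorphism, and the lift stays at
  bounded distance from a linear map A, the same one for all c. The matrix that belongs to the
  inverse of h inverts A, and A comes from an automorphism of the solenoid because it maps the
  lattices defined by the coordinates into each other. Bounded distance is invisible at infinity,
  so the sphere map of A carries points of perspective to points of perspective.
*)
theory Submission
  imports Defs
begin

section \<open>Topology of the circle and the torus\<close>

text \<open>A coordinate of \<open>h\<close> may depend on every coordinate of its argument, so
  \<open>h\<close> need not cover a map of tori and its lift need not have exact periods. Hence the
  control up to errors, with tolerance 1/4: a continuous function within 1/4 of the integers follows
  a single integer, and three such errors sum to less than 1, so the integers attached to lattice
  increments add exactly. That A does not depend on c comes from density: the image of
  \<open>solenoid_proj M\<close> realises every point of the solenoid on finitely many coordinates,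
  so the component of c is imitated by a translate of the component of 0. The errors disappear again
  because two matrices at bounded distance are equal, which makes BA = 1 and the integrality
  relations exact. The translation part of \<open>h\<close> is bounded and therefore leaves no trace
  in A, as it should: it does not act on the sphere at infinity.\<close>

lift_definition circle_exp :: "circle \<Rightarrow> complex" is "\<lambda>x. cis (2 * pi * x)"
proof -
  fix x y :: real assume "int_cong x y"
  then obtain n where "x = y + of_int n"
    unfolding int_cong_def Ints_def by (auto simp: algebra_simps)
  then show "cis (2 * pi * x) = cis (2 * pi * y)"
    by (simp add: distrib_left flip: cis_mult)
qed

lemma circle_exp_to_circle: "circle_exp (to_circle x) = cis (2 * pi * x)"
  by (rule circle_exp.abs_eq)

lemma to_circle_eq_iff: "to_circle x = to_circle y \<longleftrightarrow> x - y \<in> \<int>"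
  using circle.abs_eq_iff by (simp add: int_cong_def)

lemma ex_to_circle: "\<exists>a. x = to_circle a"
  by (metis Quotient3_abs_rep[OF Quotient3_circle])

lemma to_circle_add: "to_circle (x + y) = to_circle x + to_circle y"
  by (simp add: plus_circle.abs_eq)

lemma to_circle_minus: "to_circle (- x) = - to_circle x"
  by (simp add: uminus_circle.abs_eq)

lemma to_circle_diff: "to_circle (x - y) = to_circle x - to_circle y"
  using to_circle_add[of x "- y"] by (simp add: to_circle_minus)

lemma to_circle_0: "to_circle 0 = 0"
  by (simp add: zero_circle.abs_eq)

lemma circle_exp_add: "circle_exp (x + y) = circle_exp x * circle_exp y"
  by transfer (simp add: distrib_left cis_mult)

lemma circle_exp_uminus: "circle_exp (- x) = cnj (circle_exp x)"
  by transfer (simp add: cis_cnj)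

lemma norm_circle_exp: "norm (circle_exp x) = 1"
  by transfer simp

text \<open>Injectivity into the complex numbers is what lets the quotient topology inherit the
  Hausdorff property.\<close>

lemma inj_circle_exp: "inj circle_exp"
proof (rule injI)
  fix x y assume *: "circle_exp x = circle_exp y"
  obtain a b where ab: "x = to_circle a" "y = to_circle b"
    using ex_to_circle by metis
  from * have "cis (2 * pi * (a - b)) = 1"
    by (simp add: ab circle_exp_to_circle right_diff_distrib flip: cis_divide)
  then obtain n where "2 * pi * (a - b) = of_int n * (2 * pi)"
    by (auto simp: complex_eq_iff cos_one_2pi_int)
  then have "a - b = of_int n" by simp
  then show "x = y" by (simp add: ab to_circle_eq_iff)
qed

lemma continuous_on_to_circle: "continuous_on UNIV to_circle"
  by (simp add: continuous_on_open_vimage open_circle_def)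

lemma continuous_on_circle_iff:
  "continuous_on UNIV f \<longleftrightarrow> continuous_on UNIV (\<lambda>x. f (to_circle x))"
  for f :: "circle \<Rightarrow> 'a::topological_space"
  by (simp add: continuous_on_open_vimage open_circle_def vimage_def)

lemma continuous_on_circle_exp: "continuous_on UNIV circle_exp"
  by (simp add: continuous_on_circle_iff circle_exp_to_circle cis_conv_exp) (intro continuous_intros)

instance circle :: t2_space
proof
  fix x y :: circle assume "x \<noteq> y"
  then have "circle_exp x \<noteq> circle_exp y" using inj_circle_exp by (auto dest: injD)
  then obtain U V where UV: "open U" "open V" "circle_exp x \<in> U" "circle_exp y \<in> V" "U \<inter> V = {}"
    using hausdorff by metis
  then have "open (circle_exp -` U)" "open (circle_exp -` V)"
    using continuous_on_circle_exp by (simp_all add: continuous_on_open_vimage)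
  then show "\<exists>U V. open U \<and> open V \<and> x \<in> U \<and> y \<in> V \<and> U \<inter> V = {}"
    using UV by (intro exI[of _ "circle_exp -` U"] exI[of _ "circle_exp -` V"]) auto
qed

lemma to_circle_frac: "to_circle (frac x) = to_circle x"
  by (simp add: to_circle_eq_iff frac_def)

lemma compact_circle: "compact (UNIV :: circle set)"
proof -
  have "x \<in> to_circle ` {0..1}" for x
  proof -
    obtain a where "x = to_circle a" using ex_to_circle by blast
    then have "x = to_circle (frac a)" by (simp add: to_circle_frac)
    then show ?thesis by (simp add: frac_ge_0 frac_lt_1 less_imp_le)
  qed
  then have "to_circle ` {0..1} = UNIV" by blast
  then show ?thesis
    by (metis compact_Icc compact_continuous_image continuous_on_subset continuous_on_to_circle subset_UNIV)
qed

text \<open>A continuous injection of a compact space into a Hausdorff space has a continuous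
  inverse on its image. Convergence can thus be tested in the complex numbers, where sums become
  products and negation becomes conjugation.\<close>

lemma tendsto_circle_exp_iff:
  "(f \<longlongrightarrow> l) F \<longleftrightarrow> ((\<lambda>x. circle_exp (f x)) \<longlongrightarrow> circle_exp l) F"
proof
  assume "(f \<longlongrightarrow> l) F"
  then show "((\<lambda>x. circle_exp (f x)) \<longlongrightarrow> circle_exp l) F"
    using continuous_on_tendsto_compose[OF continuous_on_circle_exp] by simp
next
  assume *: "((\<lambda>x. circle_exp (f x)) \<longlongrightarrow> circle_exp l) F"
  obtain g where g: "homeomorphism UNIV (range circle_exp) circle_exp g"
    using homeomorphism_compact[OF compact_circle continuous_on_circle_exp refl inj_circle_exp] by blast
  have "((\<lambda>x. g (circle_exp (f x))) \<longlongrightarrow> g (circle_exp l)) F"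
    using g by (intro continuous_on_tendsto_compose[OF _ *]) (auto simp: homeomorphism_def)
  then show "(f \<longlongrightarrow> l) F" using g by (simp add: homeomorphism_def)
qed

instance circle :: topological_ab_group_add
proof
  fix a b :: circle
  have "((\<lambda>x. circle_exp (fst x)) \<longlongrightarrow> circle_exp a) (nhds a \<times>\<^sub>F nhds b)"
    "((\<lambda>x. circle_exp (snd x)) \<longlongrightarrow> circle_exp b) (nhds a \<times>\<^sub>F nhds b)"
    by (simp_all add: filterlim_fst filterlim_snd flip: tendsto_circle_exp_iff)
  then show "LIM x nhds a \<times>\<^sub>F nhds b. fst x + snd x :> nhds (a + b)"
    unfolding tendsto_circle_exp_iff[of _ "a + b"] circle_exp_add by (rule tendsto_mult)
  have "((\<lambda>x. circle_exp x) \<longlongrightarrow> circle_exp a) (nhds a)"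
    by (simp add: filterlim_ident flip: tendsto_circle_exp_iff)
  then show "(uminus \<longlongrightarrow> - a) (nhds a)"
    unfolding tendsto_circle_exp_iff[of _ "- a"] circle_exp_uminus by (rule tendsto_cnj)
qed

lemma continuous_on_int_scale: "continuous_on UNIV (int_scale k)"
  unfolding continuous_on_circle_iff int_scale.abs_eq
  by (rule continuous_on_compose2[OF continuous_on_to_circle]) (auto intro!: continuous_intros)

lemma continuous_on_torus_proj: "continuous_on UNIV torus_proj"
  unfolding torus_proj_def
  by (intro continuous_on_vec_lambda continuous_on_compose2[OF continuous_on_to_circle])
     (auto intro!: continuous_intros)

lemma continuous_on_torus_map: "continuous_on UNIV (torus_map A)"
  unfolding torus_map_def
  by (intro continuous_on_vec_lambda continuous_on_sum continuous_on_compose2[OF continuous_on_int_scale])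
     (auto intro!: continuous_intros)

lemma compact_torus: "compact (UNIV :: 'n::finite torus set)"
proof -
  have "x \<in> torus_proj ` cbox 0 1" for x :: "'n torus"
  proof -
    obtain a where "x = torus_proj a" using surj_torus_proj by blast
    then have "x = torus_proj (\<chi> i. frac (a $ i))"
      by (simp add: torus_proj_def to_circle_frac)
    moreover have "(\<chi> i. frac (a $ i)) \<in> cbox 0 1"
      by (simp add: mem_box_cart frac_ge_0 frac_lt_1 less_imp_le)
    ultimately show ?thesis by blast
  qed
  then have "torus_proj ` (cbox 0 1 :: (real^'n) set) = UNIV" by blast
  then show ?thesis
    by (metis compact_cbox compact_continuous_image continuous_on_subset continuous_on_torus_proj subset_UNIV)
qed

lemma torus_proj_add: "torus_proj (x + y) = torus_proj x + torus_proj y"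
  by (simp add: torus_proj_def vec_eq_iff to_circle_add)

lemma torus_proj_diff: "torus_proj (x - y) = torus_proj x - torus_proj y"
  by (simp add: torus_proj_def vec_eq_iff to_circle_diff)

lemma torus_proj_0: "torus_proj 0 = 0"
  by (simp add: torus_proj_def vec_eq_iff to_circle_0)

lemma torus_proj_eq_iff: "torus_proj x = torus_proj y \<longleftrightarrow> (\<forall>i. x $ i - y $ i \<in> \<int>)"
  by (simp add: torus_proj_def vec_eq_iff to_circle_eq_iff)

lemma torus_map_add: "torus_map A (x + y) = torus_map A x + torus_map A y"
proof -
  obtain a b where "x = torus_proj a" "y = torus_proj b"
    using surj_torus_proj by (metis surjD)
  then show ?thesis
    by (simp add: torus_map_torus_proj matrix_vector_right_distrib flip: torus_proj_add)
qed

lemma torus_map_diff: "torus_map A (x - y) = torus_map A x - torus_map A y"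
  using torus_map_add[of A "x - y" y] by (simp add: algebra_simps)

text \<open>A normed space is contractible, so a nowhere vanishing function on it has a continuous
  logarithm. Modulus 1 makes that logarithm purely imaginary, and division by 2 pi gives the
  lift.\<close>

lemma circle_lift:
  fixes f :: "'a::real_normed_vector \<Rightarrow> circle"
  assumes "continuous_on UNIV f"
  obtains F where "continuous_on UNIV F" "\<And>s. f s = to_circle (F s)"
proof -
  have "continuous_on UNIV (\<lambda>s. circle_exp (f s))"
    by (rule continuous_on_compose2[OF continuous_on_circle_exp assms]) simp
  moreover have "contractible (UNIV :: 'a set)"
    by (simp add: convex_imp_contractible)
  ultimately obtain g where g: "continuous_on UNIV g" "\<And>s. circle_exp (f s) = exp (g s)"
    using norm_circle_exp
    by (metis UNIV_I continuous_logarithm_on_contractible norm_zero zero_neq_one)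
  show thesis
  proof
    show "continuous_on UNIV (\<lambda>s. Im (g s) / (2 * pi))"
      by (intro continuous_intros g) auto
    fix s
    have "norm (exp (g s)) = 1" by (metis g(2) norm_circle_exp)
    then have "Re (g s) = 0" by simp
    then have "exp (g s) = cis (Im (g s))" by (simp add: exp_eq_polar)
    then have "circle_exp (f s) = circle_exp (to_circle (Im (g s) / (2 * pi)))"
      by (simp add: g circle_exp_to_circle)
    then show "f s = to_circle (Im (g s) / (2 * pi))"
      by (rule injD[OF inj_circle_exp])
  qed
qed

lemma torus_lift:
  fixes f :: "'a::real_normed_vector \<Rightarrow> 'n::finite torus"
  assumes "continuous_on UNIV f"
  obtains F where "continuous_on UNIV F" "\<And>s. f s = torus_proj (F s)"
proof -
  have "\<exists>F. continuous_on UNIV F \<and> (\<forall>s. f s $ i = to_circle (F s))" for i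
    using circle_lift[OF continuous_on_component[OF assms]] by metis
  then obtain F where F: "\<And>i. continuous_on UNIV (F i)" "\<And>i s. f s $ i = to_circle (F i s)"
    by metis
  show thesis
  proof
    show "continuous_on UNIV (\<lambda>s. \<chi> i. F i s)" by (intro continuous_intros F)
    show "f s = torus_proj (\<chi> i. F i s)" for s by (simp add: torus_proj_def vec_eq_iff F)
  qed
qed

text \<open>The common tolerance for being nearly integral. Any radius up to 1/3 would keep the
  three errors in \<open>near_integers_eq\<close> below 1 in total.\<close>

definition circle_near_0 :: "circle set"
  where "circle_near_0 = to_circle ` {-1/4<..<1/4}"

lemma to_circle_in_near_0_iff: "to_circle x \<in> circle_near_0 \<longleftrightarrow> (\<exists>m::int. \<bar>x - of_int m\<bar> < 1/4)"
proof
  assume "to_circle x \<in> circle_near_0"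
  then obtain y where "y \<in> {-1/4<..<1/4}" "to_circle x = to_circle y"
    unfolding circle_near_0_def by blast
  then have y: "\<bar>y\<bar> < 1/4" "x - y \<in> \<int>"
    by (auto simp: to_circle_eq_iff abs_less_iff)
  then obtain m where "x - y = of_int m" by (auto elim: Ints_cases)
  then have "y = x - of_int m" by simp
  then show "\<exists>m::int. \<bar>x - of_int m\<bar> < 1/4" using y by auto
next
  assume "\<exists>m::int. \<bar>x - of_int m\<bar> < 1/4"
  then obtain m :: int where m: "\<bar>x - of_int m\<bar> < 1/4" by blast
  have "to_circle x = to_circle (x - of_int m)" by (simp add: to_circle_eq_iff)
  moreover have "x - of_int m \<in> {-1/4<..<1/4}" using m unfolding abs_less_iff by auto
  ultimately show "to_circle x \<in> circle_near_0" unfolding circle_near_0_def by blast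
qed

lemma open_circle_near_0: "open circle_near_0"
proof -
  have "to_circle -` circle_near_0 = (\<Union>m::int. {x. \<bar>x - of_int m\<bar> < 1/4})"
    by (auto simp: to_circle_in_near_0_iff)
  moreover have "open {x::real. \<bar>x - of_int m\<bar> < 1/4}" for m :: int
    by (intro open_Collect_less continuous_intros)
  ultimately show ?thesis by (auto simp: open_circle_def)
qed

lemma zero_in_circle_near_0: "0 \<in> circle_near_0"
  unfolding to_circle_0[symmetric] to_circle_in_near_0_iff by (intro exI[of _ 0]) simp

section \<open>Compactness of the solenoid\<close>

lemma solenoid_eq_below:
  assumes "x \<in> solenoid M" "y \<in> solenoid M" "x j = y j" "i \<le> j"
  shows "x i = y i"
  using assms(4,3)
proof (induction rule: inc_induct)
  case (step k)
  then have "torus_map (M k) (x (Suc k)) = torus_map (M k) (y (Suc k))" by simp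
  then show ?case using assms(1,2) by (simp add: solenoid_def)
qed

lemma compact_solenoid: "compact (solenoid M)"
  for M :: "nat \<Rightarrow> int ^ 'n ^ 'n"
proof -
  have comp: "compact (UNIV :: (nat \<Rightarrow> 'n torus) set)"
    using compact_torus
    by (metis compact_space_product_topology compact_space_def compactin_euclidean_iff
        euclidean_product_topology topspace_euclidean)
  have eq: "solenoid M = (\<Inter>j. \<Inter>k. {x. torus_map (M j) (x (Suc j)) $ k = x j $ k})"
    by (auto simp: solenoid_def vec_eq_iff)
  have "closed {x :: nat \<Rightarrow> 'n torus. torus_map (M j) (x (Suc j)) $ k = x j $ k}" for j k
    by (intro closed_Collect_eq continuous_on_component continuous_on_product_coordinates
        continuous_on_compose2[OF continuous_on_torus_map]) auto
  then have "closed (solenoid M)" unfolding eq by (intro closed_INT ballI) auto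
  then show ?thesis using compact_Int_closed[OF comp] by simp
qed

text \<open>Uniform continuity in coordinate form. Since a coordinate determines all earlier ones,
  the closed conditions that x and y agree in coordinate j are nested. If each met the compact set
  of bad pairs, a common bad pair would agree in all coordinates, although f x - f x = 0 is not
  bad.\<close>

lemma solenoid_uniform_circle:
  fixes f :: "(nat \<Rightarrow> 'n::finite torus) \<Rightarrow> circle"
  assumes f: "continuous_on (solenoid M) f"
  shows "\<exists>j. \<forall>x\<in>solenoid M. \<forall>y\<in>solenoid M. x j = y j \<longrightarrow> f x - f y \<in> circle_near_0"
proof (rule ccontr)
  assume contra: "\<not> ?thesis"
  let ?S = "solenoid M"
  define X where "X = {p \<in> ?S \<times> ?S. f (fst p) - f (snd p) \<in> - circle_near_0}"
  define C where "C j = (\<Inter>k. {p :: (nat \<Rightarrow> 'n torus) \<times> (nat \<Rightarrow> 'n torus). fst p j $ k = snd p j $ k})" for j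
  have C_iff: "p \<in> C j \<longleftrightarrow> fst p j = snd p j" for p j by (auto simp: C_def vec_eq_iff)
  have "closedin (top_of_set (?S \<times> ?S)) ((?S \<times> ?S) \<inter> (\<lambda>p. f (fst p) - f (snd p)) -` (- circle_near_0))"
    by (intro continuous_closedin_preimage continuous_on_diff
        continuous_on_compose2[OF f continuous_on_fst[OF continuous_on_id]]
        continuous_on_compose2[OF f continuous_on_snd[OF continuous_on_id]])
       (auto simp: open_circle_near_0 closed_Compl)
  moreover have "X = (?S \<times> ?S) \<inter> (\<lambda>p. f (fst p) - f (snd p)) -` (- circle_near_0)"
    by (auto simp: X_def)
  ultimately have "compact X"
    using closedin_compact compact_Times compact_solenoid by metis
  moreover have "closed (C j)" for j
    unfolding C_def
    by (intro closed_INT ballI closed_Collect_eq continuous_on_component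
        continuous_on_product_then_coordinatewise[OF continuous_on_fst[OF continuous_on_id]]
        continuous_on_product_then_coordinatewise[OF continuous_on_snd[OF continuous_on_id]])
  moreover have "X \<inter> \<Inter> (C ` I') \<noteq> {}" if I': "finite I'" "I' \<subseteq> UNIV" for I'
  proof -
    obtain N where N: "\<And>i. i \<in> I' \<Longrightarrow> i \<le> N" using I' finite_nat_set_iff_bounded_le by auto
    obtain x y where xy: "x \<in> ?S" "y \<in> ?S" "x N = y N" "f x - f y \<notin> circle_near_0"
      using contra by blast
    have "(x, y) \<in> C i" if "i \<in> I'" for i
      using solenoid_eq_below[OF xy(1-3) N[OF that]] by (simp add: C_iff)
    moreover have "(x, y) \<in> X" using xy by (simp add: X_def)
    ultimately show ?thesis by blast
  qed
  ultimately have "X \<inter> \<Inter> (range C) \<noteq> {}"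
    using compact_imp_fip_image[of X UNIV C] by blast
  then obtain p where "p \<in> X" "\<And>j. p \<in> C j" by blast
  then have "fst p = snd p" "f (fst p) - f (snd p) \<notin> circle_near_0"
    by (auto simp: C_iff X_def)
  then show False using zero_in_circle_near_0 by simp
qed

lemma solenoid_uniform_torus:
  fixes f :: "(nat \<Rightarrow> 'n::finite torus) \<Rightarrow> 'm::finite torus"
  assumes f: "continuous_on (solenoid M) f"
  obtains j where "\<And>x y k. x \<in> solenoid M \<Longrightarrow> y \<in> solenoid M \<Longrightarrow> x j = y j \<Longrightarrow>
    f x $ k - f y $ k \<in> circle_near_0"
proof -
  obtain J where J: "\<And>k x y. x \<in> solenoid M \<Longrightarrow> y \<in> solenoid M \<Longrightarrow> x (J k) = y (J k) \<Longrightarrow>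
      f x $ k - f y $ k \<in> circle_near_0"
    using solenoid_uniform_circle[OF continuous_on_component[OF f]] by metis
  \<comment> \<open>There are finitely many k, and agreement in the largest index forces agreement
    in all the others.\<close>
  have "J k \<le> Max (range J)" for k by simp
  then show thesis using solenoid_eq_below J by (metis that)
qed

section \<open>Almost periodic real functions\<close>

text \<open>If the nearest integer changed, the intermediate value theorem would make D pass through
  a half-integer, which is at distance at least 1/2 from every integer.\<close>

lemma near_integer_constant:
  fixes D :: "'a::real_normed_vector \<Rightarrow> real"
  assumes D: "continuous_on UNIV D" and near: "\<And>u. \<exists>m::int. \<bar>D u - of_int m\<bar> < 1/4"
  obtains m :: int where "\<And>u. \<bar>D u - of_int m\<bar> < 1/4"
proof -
  obtain f :: "'a \<Rightarrow> int" where f: "\<And>u. \<bar>D u - of_int (f u)\<bar> < 1/4" using near by metis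
  have "is_interval (range D)"
    using connected_continuous_image[OF D connected_UNIV] by (simp add: is_interval_connected_1)
  have le: "f u \<le> f w" for u w
  proof (rule ccontr)
    assume "\<not> f u \<le> f w"
    then have "f w + 1 \<le> f u" by simp
    then have "of_int (f w) + 1 \<le> (of_int (f u) :: real)" by linarith
    with f[of u] f[of w] have "D w \<le> of_int (f w) + 1/2" "of_int (f w) + 1/2 \<le> D u"
      by linarith+
    then have "of_int (f w) + 1/2 \<in> range D"
      using \<open>is_interval (range D)\<close> unfolding is_interval_1 by blast
    then obtain v where v: "D v = of_int (f w) + 1/2" by auto
    define d where "d = f w - f v"
    from f[of v] v have "\<bar>of_int d + 1/2\<bar> < (1/4 :: real)" by (simp add: d_def algebra_simps)
    then have "real_of_int d < 0" "of_int (-1) < real_of_int d" by linarith+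
    then show False unfolding of_int_less_iff by simp
  qed
  show thesis
  proof
    show "\<bar>D u - of_int (f 0)\<bar> < 1/4" for u using f[of u] le[of u 0] le[of 0 u] by simp
  qed
qed

lemma near_integers_eq:
  fixes a b :: int
  assumes "\<bar>x - of_int a\<bar> < (1/4 :: real)" "\<bar>y - of_int b\<bar> < 1/4" "\<bar>x + y - of_int c\<bar> < 1/4"
  shows "c = a + b"
  using assms by linarith

text \<open>Near-periodicity under the integer lattice forces an increment homomorphism on the lattice;
  after subtracting its linear extension the function is bounded because it is determined up
  to a bounded error by its values on a compact fundamental domain.\<close>

lemma near_periodic_bounded_distance_linear:
  fixes F :: "real ^ 'n \<Rightarrow> real"
  assumes F: "continuous_on UNIV F"
    and near: "\<And>u v. (\<forall>i. v $ i \<in> \<int>) \<Longrightarrow> \<exists>m::int. \<bar>F (u + v) - F u - of_int m\<bar> < 1/4"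
  obtains k :: "int ^ 'n" and B where "\<And>u. \<bar>F u - (\<Sum>i\<in>UNIV. of_int (k $ i) * u $ i)\<bar> \<le> B"
proof -
  let ?L = "{v :: real ^ 'n. \<forall>i. v $ i \<in> \<int>}"
  have "\<exists>m::int. \<forall>u. \<bar>F (u + v) - F u - of_int m\<bar> < 1/4" if v: "v \<in> ?L" for v
  proof -
    have "continuous_on UNIV (\<lambda>u. F (u + v) - F u)"
      by (intro continuous_intros continuous_on_compose2[OF F]) auto
    then show ?thesis using near_integer_constant near v by (metis (no_types, lifting) mem_Collect_eq)
  qed
  then obtain m :: "real ^ 'n \<Rightarrow> int"
    where m: "\<And>u v. v \<in> ?L \<Longrightarrow> \<bar>F (u + v) - F u - of_int (m v)\<bar> < 1/4" by metis
  \<comment> \<open>Since \<open>m w\<close> serves every base point, the increment along v + w from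
    0 may be split at v.\<close>
  have m_add: "m (v + w) = m v + m w" if "v \<in> ?L" "w \<in> ?L" for v w
  proof (rule near_integers_eq)
    show "\<bar>F (0 + v) - F 0 - of_int (m v)\<bar> < 1/4" using m that by blast
    show "\<bar>F (0 + v + w) - F (0 + v) - of_int (m w)\<bar> < 1/4" using m that by blast
    have "v + w \<in> ?L" using that by auto
    from m[OF this, of 0]
    show "\<bar>F (0 + v) - F 0 + (F (0 + v + w) - F (0 + v)) - of_int (m (v + w))\<bar> < 1/4"
      by (simp add: algebra_simps)
  qed
  have m_0: "m 0 = 0" using m_add[of 0 0] by simp
  define e where "e i = (axis i 1 :: real ^ 'n)" for i
  have e: "real_of_int a *s e i \<in> ?L" for a i
    by (auto simp: e_def axis_def)
  have m_scale: "m (of_int a *s e i) = a * m (e i)" for a i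
  proof (induction a rule: int_induct[of _ 0])
    case base
    then show ?case by (simp add: m_0)
  next
    case (step1 a)
    then show ?case using m_add[OF e[of a i] e[of 1 i]] by (simp add: vector_sadd_rdistrib algebra_simps)
  next
    case (step2 a)
    then show ?case using m_add[OF e[of "a - 1" i] e[of 1 i]]
      by (simp add: algebra_simps vector_sadd_rdistrib[symmetric])
  qed
  have m_sum: "m (\<Sum>i\<in>I. g i) = (\<Sum>i\<in>I. m (g i)) \<and> (\<Sum>i\<in>I. g i) \<in> ?L"
    if "finite I" "\<And>i. i \<in> I \<Longrightarrow> g i \<in> ?L" for g and I :: "'n set"
    using that
  proof (induction I)
    case empty
    then show ?case by (simp add: m_0)
  next
    case (insert i I)
    then have "g i \<in> ?L" "(\<Sum>i\<in>I. g i) \<in> ?L" "m (\<Sum>i\<in>I. g i) = (\<Sum>i\<in>I. m (g i))" by simp_all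
    then show ?case using insert m_add[of "g i" "\<Sum>i\<in>I. g i"] by simp
  qed
  define k where "k = (\<chi> i. m (e i))"
  define l where "l u = (\<Sum>i\<in>UNIV. of_int (k $ i) * u $ i)" for u :: "real ^ 'n"
  define fr where "fr u = (\<chi> i. frac (u $ i))" for u :: "real ^ 'n"
  define fl where "fl u = (\<Sum>i\<in>UNIV. of_int \<lfloor>u $ i\<rfloor> *s e i)" for u :: "real ^ 'n"
  have fl_nth: "fl u $ i = of_int \<lfloor>u $ i\<rfloor>" for u i
    by (simp add: fl_def e_def axis_def if_distrib cong: if_cong)
  have split: "u = fr u + fl u" for u by (simp add: vec_eq_iff fl_nth fr_def frac_def)
  have m_fl: "of_int (m (fl u)) = l (fl u)" for u
  proof -
    have "m (fl u) = (\<Sum>i\<in>UNIV. m (of_int \<lfloor>u $ i\<rfloor> *s e i))"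
      unfolding fl_def by (rule conjunct1[OF m_sum[OF finite e]])
    also have "\<dots> = (\<Sum>i\<in>UNIV. k $ i * \<lfloor>u $ i\<rfloor>)" by (simp only: m_scale) (simp add: k_def mult.commute)
    finally show ?thesis by (simp add: l_def fl_nth)
  qed
  have l_add: "l (u + v) = l u + l v" for u v by (simp add: l_def distrib_left sum.distrib)
  have "continuous_on (cbox 0 1) (\<lambda>u. F u - l u)"
    unfolding l_def by (intro continuous_intros continuous_on_subset[OF F]) auto
  then have "bounded ((\<lambda>u. F u - l u) ` cbox 0 1)"
    by (intro compact_imp_bounded compact_continuous_image) auto
  then obtain B where B: "\<And>u. u \<in> cbox 0 1 \<Longrightarrow> \<bar>F u - l u\<bar> \<le> B" by (auto simp: bounded_iff)
  \<comment> \<open>The bound consists of B for the unit cube and 1/4 for the increment along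
    \<open>fl u\<close>.\<close>
  show thesis
  proof
    fix u
    have "fl u \<in> ?L" by (simp add: fl_nth)
    from m[OF this, of "fr u"] have 1: "\<bar>F u - F (fr u) - l (fl u)\<bar> < 1/4"
      by (simp add: m_fl flip: split)
    have "fr u \<in> cbox 0 1" by (simp add: fr_def mem_box_cart frac_ge_0 frac_lt_1 less_imp_le)
    then have 2: "\<bar>F (fr u) - l (fr u)\<bar> \<le> B" by (rule B)
    have "l u = l (fr u) + l (fl u)" by (metis l_add split)
    with 1 2 show "\<bar>F u - (\<Sum>i\<in>UNIV. of_int (k $ i) * u $ i)\<bar> \<le> B + 1/4"
      unfolding l_def[symmetric] by linarith
  qed
qed

lemma near_periodic_bounded_distance_matrix:
  fixes F :: "real ^ 'n \<Rightarrow> real ^ 'n"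
  assumes F: "continuous_on UNIV F"
    and near: "\<And>u v i. (\<forall>i. v $ i \<in> \<int>) \<Longrightarrow> \<exists>m::int. \<bar>F (u + v) $ i - F u $ i - of_int m\<bar> < 1/4"
  obtains K :: "int ^ 'n ^ 'n" where "bounded (range (\<lambda>u. F u - real_matrix K *v u))"
proof -
  have "\<exists>(k :: int ^ 'n) B. \<forall>u. \<bar>F u $ i - (\<Sum>j\<in>UNIV. of_int (k $ j) * u $ j)\<bar> \<le> B" for i
    by (rule near_periodic_bounded_distance_linear[OF continuous_on_component[OF F] near]) auto
  then obtain k :: "'n \<Rightarrow> int ^ 'n" and B
    where kB: "\<And>i u. \<bar>F u $ i - (\<Sum>j\<in>UNIV. of_int (k i $ j) * u $ j)\<bar> \<le> B i" by metis
  show thesis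
  proof
    have "norm (F u - real_matrix (\<chi> i. k i) *v u) \<le> (\<Sum>i\<in>UNIV. B i)" for u
      by (rule order_trans[OF norm_le_l1_cart])
         (auto intro!: sum_mono kB simp: matrix_vector_mult_def real_matrix_def)
    then show "bounded (range (\<lambda>u. F u - real_matrix (\<chi> i. k i) *v u))"
      unfolding bounded_iff by blast
  qed
qed

section \<open>Matrices and bounded distance\<close>

text \<open>A bounded linear image of the whole space is zero, as scaling s shows. This uniqueness
  turns comparisons up to bounded error into matrix identities.\<close>

lemma matrix_eq_of_bounded_diff:
  fixes A B :: "real ^ 'n ^ 'm"
  assumes "bounded (range (\<lambda>s. A *v s - B *v s))"
  shows "A = B"
proof -
  obtain K where K: "\<And>s. norm ((A - B) *v s) \<le> K"
    using assms by (auto simp: bounded_iff matrix_vector_mult_diff_rdistrib)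
  have "(A - B) *v s = 0" for s
  proof (rule ccontr)
    assume nz: "(A - B) *v s \<noteq> 0"
    obtain n :: nat where n: "K < of_nat n * norm ((A - B) *v s)"
      using reals_Archimedean3[of "norm ((A - B) *v s)"] nz by auto
    have "norm ((A - B) *v (of_nat n *\<^sub>R s)) = of_nat n * norm ((A - B) *v s)"
      by (simp add: matrix_vector_mult_scaleR)
    then show False using K[of "of_nat n *\<^sub>R s"] n by linarith
  qed
  then show ?thesis by (simp add: matrix_eq matrix_vector_mult_diff_rdistrib)
qed

lemma bounded_range_matrix_vector_mult:
  fixes A :: "real ^ 'n ^ 'm"
  assumes "bounded (range f)"
  shows "bounded (range (\<lambda>s. A *v f s))"
  using bounded_linear_image[OF assms matrix_vector_mul_bounded_linear[of A]] by (simp add: image_image)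

lemma integer_valued_continuous_constant:
  fixes D :: "'a::real_normed_vector \<Rightarrow> real ^ 'n"
  assumes D: "continuous_on UNIV D" and int: "\<And>s i. D s $ i \<in> \<int>"
  shows "D s = D t"
proof -
  have "D s $ i = D t $ i" for i
  proof -
    have "\<exists>m::int. \<bar>D u $ i - of_int m\<bar> < 1/4" for u
    proof -
      obtain z where "D u $ i = of_int z" using int[of u i] by (auto elim: Ints_cases)
      then show ?thesis by (intro exI[of _ z]) simp
    qed
    then obtain m :: int where m: "\<And>u. \<bar>D u $ i - of_int m\<bar> < 1/4"
      using near_integer_constant[OF continuous_on_component[OF D]] by metis
    have "D u $ i = of_int m" for u
    proof -
      obtain z where z: "D u $ i = of_int z" using int[of u i] by (auto elim: Ints_cases)
      then have "z = m" using m[of u] by linarith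
      then show ?thesis by (simp add: z)
    qed
    then show ?thesis by simp
  qed
  then show ?thesis by (simp add: vec_eq_iff)
qed

lemma continuous_on_matrix_vector_mult:
  fixes A :: "real ^ 'n ^ 'm"
  assumes "continuous_on S f"
  shows "continuous_on S (\<lambda>s. A *v f s)"
  by (rule bounded_linear.continuous_on[OF matrix_vector_mul_bounded_linear assms])

lemma invertible_matrix_inv_mult:
  fixes A :: "real ^ 'n ^ 'n"
  assumes "invertible A"
  shows "A ** matrix_inv A = mat 1" "matrix_inv A ** A = mat 1" "invertible (matrix_inv A)"
    "A *v (matrix_inv A *v s) = s" "matrix_inv A *v (A *v s) = s"
proof -
  show *: "A ** matrix_inv A = mat 1" "matrix_inv A ** A = mat 1"
    using someI_ex[OF assms[unfolded invertible_def]] by (simp_all add: matrix_inv_def)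
  then show "invertible (matrix_inv A)" unfolding invertible_def by blast
  show "A *v (matrix_inv A *v s) = s" "matrix_inv A *v (A *v s) = s"
    by (simp_all add: matrix_vector_mul_assoc *)
qed

section \<open>Coordinates of the solenoid and of its covering space\<close>

lemma solenoid_diff:
  "x \<in> solenoid M \<Longrightarrow> y \<in> solenoid M \<Longrightarrow> (\<lambda>j. x j - y j) \<in> solenoid M"
  by (simp add: solenoid_def torus_map_diff)

lemma seq_add_in_solenoid:
  "x \<in> solenoid M \<Longrightarrow> y \<in> solenoid M \<Longrightarrow> seq_add x y \<in> solenoid M"
  by (simp add: solenoid_def seq_add_def torus_map_add)

lemma torus_map_0: "torus_map A 0 = 0"
  using torus_map_diff[of A 0 0] by simp

lemma zero_in_fibre: "(\<lambda>j. 0) \<in> fibre M"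
  by (simp add: fibre_def solenoid_def torus_map_0)

text \<open>With matrices numbered from 1 this is the inverse of M_1 ... M_j. Coordinate
  \<open>j\<close> therefore sees s modulo the lattice M_1 ... M_j Z^n, and these lattices decrease
  with \<open>j\<close>.\<close>

primrec inv_iter_matrix :: "(nat \<Rightarrow> int ^ 'n ^ 'n) \<Rightarrow> nat \<Rightarrow> real ^ 'n ^ 'n"
  where
    "inv_iter_matrix M 0 = mat 1"
  | "inv_iter_matrix M (Suc j) = matrix_inv (real_matrix (M j)) ** inv_iter_matrix M j"

lemma inv_iter_eq: "inv_iter M j s = inv_iter_matrix M j *v s"
  by (induction j) (simp_all add: matrix_vector_mul_assoc)

lemma solenoid_proj_nth: "solenoid_proj M s j = torus_proj (inv_iter_matrix M j *v s)"
  by (simp add: solenoid_proj_def inv_iter_eq)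

lemma cover_nth: "cover M (s, c) j = solenoid_proj M s j + c j"
  by (simp add: cover_def seq_add_def)

lemma cover_0: "cover M (s, \<lambda>j. 0) = solenoid_proj M s"
  by (simp add: fun_eq_iff cover_nth)

lemma cover_fst: "c \<in> fibre M \<Longrightarrow> cover M (s, c) 0 = torus_proj s"
  by (simp add: cover_nth solenoid_proj_nth fibre_def)

lemma continuous_on_cover: "continuous_on UNIV (\<lambda>s. cover M (s, c))"
proof (rule continuous_on_coordinatewise_then_product)
  fix j
  obtain d where d: "c j = torus_proj d" using surj_torus_proj by blast
  show "continuous_on UNIV (\<lambda>s. cover M (s, c) j)"
    by (simp add: cover_nth solenoid_proj_nth d flip: torus_proj_add)
       (intro continuous_on_compose2[OF continuous_on_torus_proj] continuous_on_add
          continuous_on_matrix_vector_mult continuous_on_id continuous_on_const subset_UNIV)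
qed

text \<open>A is fixed before \<open>c\<close>, so one matrix serves all components. The target
  \<open>c'\<close> is recorded so that lifts of successive maps can be composed.\<close>

definition linear_asymptotics ::
    "(nat \<Rightarrow> int ^ 'n ^ 'n) \<Rightarrow> ((nat \<Rightarrow> 'n torus) \<Rightarrow> (nat \<Rightarrow> 'n torus)) \<Rightarrow> real ^ 'n ^ 'n \<Rightarrow> bool"
  where "linear_asymptotics M h A \<longleftrightarrow>
    (\<forall>c\<in>fibre M. \<exists>G. \<exists>c'\<in>fibre M. continuous_on UNIV G \<and>
      (\<forall>s. h (cover M (s, c)) = cover M (G s, c')) \<and>
      bounded (range (\<lambda>s. G s - A *v s)))"

text \<open>For nonsingular M: A sends the lattice that coordinate \<open>j\<close> cannot see into
  the one for \<open>i\<close>, so coordinate \<open>i\<close> of the image is a function of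
  coordinate \<open>j\<close>. Dually, right multiplication by A maps the union of the row lattices
  of the \<open>inv_iter_matrix M j\<close>, which is the character group of the solenoid, into
  itself.\<close>

definition integral_conjugates :: "(nat \<Rightarrow> int ^ 'n ^ 'n) \<Rightarrow> real ^ 'n ^ 'n \<Rightarrow> bool"
  where "integral_conjugates M A \<longleftrightarrow>
    (\<forall>i. \<exists>j K. inv_iter_matrix M i ** A = real_matrix K ** inv_iter_matrix M j)"

section \<open>Lifts of solenoid maps\<close>

locale nonsingular_sequence =
  fixes M :: "nat \<Rightarrow> int ^ 'n ^ 'n"
  assumes det_nonzero: "det (M j) \<noteq> 0"
begin

lemma invertible_real_matrix: "invertible (real_matrix (M j))"
proof -
  have "det (real_matrix (M j)) = of_int (det (M j))"
    by (simp add: det_def real_matrix_def)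
  then show ?thesis using det_nonzero by (simp add: invertible_det_nz)
qed

lemma invertible_inv_iter_matrix: "invertible (inv_iter_matrix M j)"
proof (induction j)
  case 0
  have "invertible (mat 1 :: real ^ 'n ^ 'n)"
    unfolding invertible_def by (rule exI[of _ "mat 1"]) simp
  then show ?case by simp
next
  case (Suc j)
  then show ?case
    by (simp add: invertible_mult invertible_matrix_inv_mult(3) invertible_real_matrix)
qed

lemma solenoid_proj_in: "solenoid_proj M s \<in> solenoid M"
  by (simp add: solenoid_def solenoid_proj_def torus_map_torus_proj
      invertible_matrix_inv_mult invertible_real_matrix)

lemma cover_in_solenoid: "c \<in> fibre M \<Longrightarrow> cover M (s, c) \<in> solenoid M"
  by (simp add: cover_def seq_add_in_solenoid solenoid_proj_in fibre_def)

text \<open>Density of the image of R^n in coordinate form: it suffices to solve for coordinate n,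
  which determines the earlier ones.\<close>

lemma solenoid_proj_approx:
  assumes "x \<in> solenoid M"
  obtains s where "\<And>i. i \<le> n \<Longrightarrow> solenoid_proj M s i = x i"
proof -
  obtain u where u: "x n = torus_proj u" using surj_torus_proj by blast
  let ?s = "matrix_inv (inv_iter_matrix M n) *v u"
  have "solenoid_proj M ?s n = x n"
    by (simp add: solenoid_proj_nth u invertible_matrix_inv_mult invertible_inv_iter_matrix)
  then show thesis using that solenoid_eq_below[OF solenoid_proj_in assms] by blast
qed

text \<open>The fibre is totally disconnected: once coordinate j is constant, the next one stays
  among the finitely many preimages of that constant under a bonding map. In terms of a lift F, the
  matrix applied to F varies only by integer vectors, hence not at all, and the matrix is
  invertible.\<close>

lemma fibre_valued_continuous_constant:
  fixes f :: "'a::real_normed_vector \<Rightarrow> nat \<Rightarrow> 'n torus"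
  assumes f: "continuous_on UNIV f" and fib: "\<And>s. f s \<in> fibre M"
  shows "f s = f t"
proof -
  have "f s j = f t j" for j s t
  proof (induction j arbitrary: s t)
    case 0
    then show ?case using fib by (simp add: fibre_def)
  next
    case (Suc j)
    let ?P = "real_matrix (M j)"
    obtain F where F: "continuous_on UNIV F" "\<And>s. f s (Suc j) = torus_proj (F s)"
      using torus_lift[OF continuous_on_product_then_coordinatewise[OF f]] by metis
    have sol: "torus_proj (?P *v F s) = f s j" for s
      using fib[of s] by (simp add: fibre_def solenoid_def flip: F(2) torus_map_torus_proj)
    have "?P *v F s - ?P *v F t = ?P *v F t - ?P *v F t"
    proof (rule integer_valued_continuous_constant[of "\<lambda>s. ?P *v F s - ?P *v F t"])
      show "continuous_on UNIV (\<lambda>s. ?P *v F s - ?P *v F t)"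
        by (intro continuous_intros continuous_on_matrix_vector_mult F)
      show "(?P *v F s - ?P *v F t) $ i \<in> \<int>" for s i
        using Suc[of s t] by (simp add: torus_proj_eq_iff flip: sol)
    qed
    then have "?P *v F s = ?P *v F t" by simp
    then have "F s = F t" using invertible_matrix_inv_mult(5)[OF invertible_real_matrix] by metis
    then show ?case by (simp add: F)
  qed
  then show ?thesis by blast
qed

text \<open>A lift of coordinate 0 is enough. Subtracting its image under
  \<open>solenoid_proj M\<close> leaves a continuous family in the fibre, which is constant and
  serves as c'. The lifts of the later coordinates show that this family is continuous.\<close>

lemma solenoid_map_lift:
  assumes h: "continuous_on (solenoid M) h" "h ` solenoid M \<subseteq> solenoid M" and c: "c \<in> fibre M"
  obtains G c' where "continuous_on UNIV G" "c' \<in> fibre M" "\<And>s. h (cover M (s, c)) = cover M (G s, c')"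
proof -
  have cont: "continuous_on UNIV (\<lambda>s. h (cover M (s, c)))"
    by (rule continuous_on_compose2[OF h(1) continuous_on_cover]) (auto intro: cover_in_solenoid[OF c])
  then have "continuous_on UNIV (\<lambda>s. h (cover M (s, c)) j)" for j
    by (rule continuous_on_product_then_coordinatewise)
  then have "\<exists>H. continuous_on UNIV H \<and> (\<forall>s. h (cover M (s, c)) j = torus_proj (H s))" for j
    by (rule torus_lift) blast
  then obtain H where H: "\<And>j. continuous_on UNIV (H j)"
    "\<And>j s. h (cover M (s, c)) j = torus_proj (H j s)" by metis
  define f where "f s = (\<lambda>j. h (cover M (s, c)) j - solenoid_proj M (H 0 s) j)" for s
  have f_nth: "f s j = torus_proj (H j s - inv_iter_matrix M j *v H 0 s)" for s j
    by (simp add: f_def H solenoid_proj_nth torus_proj_diff)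
  have "f s \<in> solenoid M" for s
    unfolding f_def by (intro solenoid_diff solenoid_proj_in) (use h(2) cover_in_solenoid[OF c] in blast)
  moreover have "f s 0 = 0" for s by (simp add: f_nth torus_proj_0)
  ultimately have fib: "f s \<in> fibre M" for s by (simp add: fibre_def)
  have "continuous_on UNIV f"
    by (rule continuous_on_coordinatewise_then_product, unfold f_nth)
       (intro continuous_on_compose2[OF continuous_on_torus_proj] continuous_on_diff
          continuous_on_matrix_vector_mult H subset_UNIV)
  then have const: "f s = f 0" for s using fib by (rule fibre_valued_continuous_constant)
  have "h (cover M (s, c)) = cover M (H 0 s, f 0)" for s
    by (simp add: fun_eq_iff cover_nth const[of s, symmetric]) (simp add: f_def)
  then show thesis using that H(1) fib by blast
qed

text \<open>If \<open>h\<close> is nearly determined by the coordinate \<open>j\<close>, then the lift of its coordinate \<open>i\<close> is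
  nearly periodic modulo the lattice of those \<open>s\<close> with \<open>inv_iter M j s\<close> integral.\<close>

lemma coordinate_lift_near_linear:
  fixes h :: "(nat \<Rightarrow> 'n torus) \<Rightarrow> (nat \<Rightarrow> 'n torus)"
  assumes h: "continuous_on (solenoid M) h"
    and F: "continuous_on UNIV F" "\<And>s. h (solenoid_proj M s) i = torus_proj (F s)"
  obtains K j where "bounded (range (\<lambda>s. F s - (real_matrix K ** inv_iter_matrix M j) *v s))"
proof -
  obtain j where j: "\<And>x y k. x \<in> solenoid M \<Longrightarrow> y \<in> solenoid M \<Longrightarrow> x j = y j \<Longrightarrow>
      h x i $ k - h y i $ k \<in> circle_near_0"
    using solenoid_uniform_torus[OF continuous_on_product_then_coordinatewise[OF h]] by metis
  \<comment> \<open>The substitution u = \<open>?B\<close> s turns the lattice that coordinate j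
    cannot see into the integer lattice.\<close>
  let ?B = "inv_iter_matrix M j" and ?C = "matrix_inv (inv_iter_matrix M j)"
  have BC: "?B *v (?C *v s) = s" "?C *v (?B *v s) = s" for s
    by (simp_all add: invertible_matrix_inv_mult invertible_inv_iter_matrix)
  have "continuous_on UNIV (\<lambda>u. F (?C *v u))"
    by (intro continuous_on_compose2[OF F(1)] continuous_on_matrix_vector_mult) auto
  moreover have "\<exists>m::int. \<bar>F (?C *v (u + v)) $ k - F (?C *v u) $ k - of_int m\<bar> < 1/4"
    if v: "\<forall>i. v $ i \<in> \<int>" for u v k
  proof -
    have "torus_proj (u + v) = torus_proj u" using v by (simp add: torus_proj_eq_iff)
    then have "solenoid_proj M (?C *v (u + v)) j = solenoid_proj M (?C *v u) j"
      by (simp add: solenoid_proj_nth BC)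
    from j[OF solenoid_proj_in solenoid_proj_in this, of k]
    have "to_circle (F (?C *v (u + v)) $ k - F (?C *v u) $ k) \<in> circle_near_0"
      by (simp add: F(2) torus_proj_def to_circle_diff)
    then show ?thesis by (simp add: to_circle_in_near_0_iff)
  qed
  ultimately obtain K where K: "bounded (range (\<lambda>u. F (?C *v u) - real_matrix K *v u))"
    by (rule near_periodic_bounded_distance_matrix)
  have "F s - (real_matrix K ** ?B) *v s = F (?C *v (?B *v s)) - real_matrix K *v (?B *v s)" for s
    by (simp add: BC matrix_vector_mul_assoc[symmetric])
  then have "range (\<lambda>s. F s - (real_matrix K ** ?B) *v s) \<subseteq> range (\<lambda>u. F (?C *v u) - real_matrix K *v u)"
    by auto
  then show thesis using that bounded_subset[OF K] by blast
qed

text \<open>Choose u so that its image agrees with c in the coordinate j that nearly determines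
  coordinate 0 of h. By additivity the points over (s, c) and (s + u, 0) then agree in coordinate j
  for every s, so G s and F (s + u) differ by nearly one fixed integer vector.\<close>

lemma lifts_bounded_difference:
  fixes h :: "(nat \<Rightarrow> 'n torus) \<Rightarrow> (nat \<Rightarrow> 'n torus)"
  assumes h: "continuous_on (solenoid M) h" and c: "c \<in> fibre M"
    and F: "continuous_on UNIV F" "\<And>s. h (solenoid_proj M s) 0 = torus_proj (F s)"
    and G: "continuous_on UNIV G" "\<And>s. h (cover M (s, c)) 0 = torus_proj (G s)"
  obtains u where "bounded (range (\<lambda>s. G s - F (s + u)))"
proof -
  obtain j where j: "\<And>x y k. x \<in> solenoid M \<Longrightarrow> y \<in> solenoid M \<Longrightarrow> x j = y j \<Longrightarrow>
      h x 0 $ k - h y 0 $ k \<in> circle_near_0"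
    using solenoid_uniform_torus[OF continuous_on_product_then_coordinatewise[OF h]] by metis
  have "c \<in> solenoid M" using c by (simp add: fibre_def)
  then obtain u where u: "solenoid_proj M u j = c j" using solenoid_proj_approx by blast
  have "\<exists>m::int. \<forall>s. \<bar>(G s - F (s + u)) $ k - of_int m\<bar> < 1/4" for k
  proof -
    have cont: "continuous_on UNIV (\<lambda>s. (G s - F (s + u)) $ k)"
      by (intro continuous_on_component continuous_on_diff G continuous_on_compose2[OF F(1)]
          continuous_intros) auto
    have near: "\<exists>m::int. \<bar>(G s - F (s + u)) $ k - of_int m\<bar> < 1/4" for s
    proof -
      have "cover M (s, c) j = solenoid_proj M (s + u) j"
        by (simp add: cover_nth flip: u)
           (simp add: solenoid_proj_nth matrix_vector_right_distrib torus_proj_add)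
      from j[OF cover_in_solenoid[OF c] solenoid_proj_in this, of k]
      have "to_circle ((G s - F (s + u)) $ k) \<in> circle_near_0"
        by (simp add: F(2) G(2)) (simp add: torus_proj_def to_circle_diff)
      then show ?thesis by (simp add: to_circle_in_near_0_iff)
    qed
    show ?thesis by (rule near_integer_constant[OF cont near]) blast
  qed
  then obtain m :: "'n \<Rightarrow> int" where m: "\<And>k s. \<bar>(G s - F (s + u)) $ k - of_int (m k)\<bar> < 1/4" by metis
  have abs_le_m: "\<bar>(G s - F (s + u)) $ k\<bar> \<le> \<bar>of_int (m k)\<bar> + 1/4" for k s
    using m[where k=k and s=s] by linarith
  have "norm (G s - F (s + u)) \<le> (\<Sum>k\<in>UNIV. \<bar>of_int (m k)\<bar> + 1/4)" for s
    by (rule order_trans[OF norm_le_l1_cart], rule sum_mono) (use abs_le_m in blast)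
  then have "bounded (range (\<lambda>s. G s - F (s + u)))" unfolding bounded_iff by blast
  then show thesis by (rule that)
qed

lemma solenoid_map_asymptotics:
  assumes h: "continuous_on (solenoid M) h" "h ` solenoid M \<subseteq> solenoid M"
  obtains A where "linear_asymptotics M h A" "integral_conjugates M A"
proof -
  obtain F d where F: "continuous_on UNIV F" "d \<in> fibre M"
    "\<And>s. h (cover M (s, \<lambda>j. 0)) = cover M (F s, d)"
    using solenoid_map_lift[OF h zero_in_fibre] by metis
  have F0: "h (solenoid_proj M s) 0 = torus_proj (F s)" for s
    using F(3)[of s] F(2) by (simp add: cover_0 cover_fst)
  obtain K0 j0 where bA: "bounded (range (\<lambda>s. F s - (real_matrix K0 ** inv_iter_matrix M j0) *v s))"
    by (rule coordinate_lift_near_linear[OF h(1) F(1) F0])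
  define A where "A = real_matrix K0 ** inv_iter_matrix M j0"
  have bA: "bounded (range (\<lambda>s. F s - A *v s))" using bA by (simp add: A_def)
  have "linear_asymptotics M h A"
    unfolding linear_asymptotics_def
  proof
    fix c assume c: "c \<in> fibre M"
    obtain G c' where G: "continuous_on UNIV G" "c' \<in> fibre M"
      "\<And>s. h (cover M (s, c)) = cover M (G s, c')"
      using solenoid_map_lift[OF h c] by metis
    have G0: "h (cover M (s, c)) 0 = torus_proj (G s)" for s by (simp add: G cover_fst)
    obtain u where u: "bounded (range (\<lambda>s. G s - F (s + u)))"
      by (rule lifts_bounded_difference[OF h(1) c F(1) F0 G(1) G0])
    have "bounded (range (\<lambda>s. F (s + u) - A *v (s + u)))"
      by (rule bounded_subset[OF bA]) auto
    moreover have "bounded (range (\<lambda>s. A *v u))" by (simp add: image_constant_conv)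
    ultimately have "bounded (range (\<lambda>s. G s - F (s + u) + (F (s + u) - A *v (s + u)) + A *v u))"
      by (intro bounded_plus_comp u)
    then have "bounded (range (\<lambda>s. G s - A *v s))"
      by (simp add: matrix_vector_right_distrib)
    then show "\<exists>G. \<exists>c'\<in>fibre M. continuous_on UNIV G \<and>
      (\<forall>s. h (cover M (s, c)) = cover M (G s, c')) \<and> bounded (range (\<lambda>s. G s - A *v s))"
      using G by blast
  qed
  moreover have "integral_conjugates M A"
    unfolding integral_conjugates_def
  proof
    fix i
    \<comment> \<open>Coordinate i of h has the lift \<open>?B\<close> F + e, which is asymptotic to
      \<open>?B\<close> A. Near-periodicity gives the same lift an asymptotic matrix of the form K
      times some \<open>inv_iter_matrix M j\<close>, and the two must coincide.\<close>
    let ?B = "inv_iter_matrix M i"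
    obtain e where e: "d i = torus_proj e" using surj_torus_proj by blast
    have lift: "h (solenoid_proj M s) i = torus_proj (?B *v F s + e)" for s
      using F(3)[of s] by (simp add: cover_0 cover_nth solenoid_proj_nth torus_proj_add e)
    have cont: "continuous_on UNIV (\<lambda>s. ?B *v F s + e)"
      by (intro continuous_intros continuous_on_matrix_vector_mult F)
    obtain K j where
      K: "bounded (range (\<lambda>s. ?B *v F s + e - (real_matrix K ** inv_iter_matrix M j) *v s))"
      by (rule coordinate_lift_near_linear[OF h(1) cont lift])
    have "bounded (range (\<lambda>s. e))" by (simp add: image_constant_conv)
    from bounded_minus_comp[OF bounded_minus_comp[OF K this]
        bounded_range_matrix_vector_mult[OF bA, of ?B]]
    have "bounded (range (\<lambda>s. (?B ** A) *v s - (real_matrix K ** inv_iter_matrix M j) *v s))"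
      by (simp add: matrix_vector_mult_diff_distrib matrix_vector_mul_assoc algebra_simps)
    then show "\<exists>j K. ?B ** A = real_matrix K ** inv_iter_matrix M j"
      using matrix_eq_of_bounded_diff by blast
  qed
  ultimately show thesis by (rule that)
qed

text \<open>With h' lifted on the component where h lands, the composite lift G' G covers the
  identity. It differs from it by a continuous integral vector, so it is a translation, yet it is
  also at bounded distance from BA.\<close>

lemma linear_asymptotics_left_inverse:
  assumes h: "linear_asymptotics M h A" and h': "linear_asymptotics M h' B"
    and inv: "\<And>x. x \<in> solenoid M \<Longrightarrow> h' (h x) = x"
  shows "B ** A = mat 1"
proof -
  obtain G c where G: "c \<in> fibre M" "continuous_on UNIV G"
    "\<And>s. h (solenoid_proj M s) = cover M (G s, c)" "bounded (range (\<lambda>s. G s - A *v s))"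
    using h[unfolded linear_asymptotics_def, rule_format, OF zero_in_fibre] by (auto simp: cover_0)
  obtain G' c' where G': "c' \<in> fibre M" "continuous_on UNIV G'"
    "\<And>s. h' (cover M (s, c)) = cover M (G' s, c')" "bounded (range (\<lambda>s. G' s - B *v s))"
    using h'[unfolded linear_asymptotics_def, rule_format, OF G(1)] by auto
  have "torus_proj (G' (G s)) = torus_proj s" for s
  proof -
    have "solenoid_proj M s = cover M (G' (G s), c')"
      using inv[OF solenoid_proj_in] G(3) G'(3) by metis
    then have "solenoid_proj M s 0 = torus_proj (G' (G s))" by (simp add: cover_fst G')
    then show ?thesis by (simp add: solenoid_proj_nth)
  qed
  then have "(G' (G s) - s) $ i \<in> \<int>" for s i by (simp add: torus_proj_eq_iff)
  moreover have "continuous_on UNIV (\<lambda>s. G' (G s) - s)"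
    by (intro continuous_intros continuous_on_compose2[OF G'(2) G(2)]) auto
  ultimately have "G' (G s) - s = G' (G 0) - 0" for s
    by (intro integer_valued_continuous_constant[of "\<lambda>s. G' (G s) - s"])
  then have 1: "bounded (range (\<lambda>s. G' (G s) - s))" by (simp add: image_constant_conv)
  have 2: "bounded (range (\<lambda>s. G' (G s) - B *v G s))"
    by (rule bounded_subset[OF G'(4)]) auto
  have 3: "bounded (range (\<lambda>s. B *v (G s - A *v s)))"
    by (rule bounded_range_matrix_vector_mult[OF G(4)])
  from bounded_minus_comp[OF bounded_minus_comp[OF 1 2] 3]
  have "bounded (range (\<lambda>s. (B ** A) *v s - mat 1 *v s))"
    by (simp add: matrix_vector_mult_diff_distrib matrix_vector_mul_assoc)
  then show ?thesis by (rule matrix_eq_of_bounded_diff)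
qed

section \<open>From matrices to automorphisms of the solenoid\<close>

lemma integral_conjugates_endomorphism:
  assumes A: "integral_conjugates M A"
  obtains \<alpha> where "continuous_on UNIV \<alpha>" "\<And>x y. \<alpha> (seq_add x y) = seq_add (\<alpha> x) (\<alpha> y)"
    "\<And>s. \<alpha> (solenoid_proj M s) = solenoid_proj M (A *v s)"
    "\<And>i. \<exists>j. \<forall>x y. x j = y j \<longrightarrow> \<alpha> x i = \<alpha> y i"
    "\<And>x. x \<in> solenoid M \<Longrightarrow> \<alpha> x \<in> solenoid M"
proof -
  obtain J K where JK: "\<And>i. inv_iter_matrix M i ** A = real_matrix (K i) ** inv_iter_matrix M (J i)"
    using A unfolding integral_conjugates_def by metis
  \<comment> \<open>The formula makes sense on all sequences, so continuity and additivity are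
    checked coordinatewise. Only compatibility with the bonding maps requires a point of the
    solenoid.\<close>
  define \<alpha> where "\<alpha> x = (\<lambda>i. torus_map (K i) (x (J i)))" for x
  have proj: "\<alpha> (solenoid_proj M s) = solenoid_proj M (A *v s)" for s
    by (simp add: fun_eq_iff \<alpha>_def solenoid_proj_nth torus_map_torus_proj matrix_vector_mul_assoc JK)
  show thesis
  proof
    show "continuous_on UNIV \<alpha>"
      unfolding \<alpha>_def
      by (rule continuous_on_coordinatewise_then_product)
         (intro continuous_on_compose2[OF continuous_on_torus_map] continuous_on_product_coordinates, auto)
    show "\<alpha> (seq_add x y) = seq_add (\<alpha> x) (\<alpha> y)" for x y
      by (simp add: \<alpha>_def seq_add_def torus_map_add)
    show "\<exists>j. \<forall>x y. x j = y j \<longrightarrow> \<alpha> x i = \<alpha> y i" for i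
      unfolding \<alpha>_def by (rule exI[of _ "J i"]) simp
    show "\<alpha> x \<in> solenoid M" if x: "x \<in> solenoid M" for x
      unfolding solenoid_def
    proof (intro CollectI allI)
      fix i
      \<comment> \<open>Both sides involve only coordinates \<open>J i\<close> and
        \<open>J (Suc i)\<close> of x, so x may be replaced by a point in the image of R^n, where
        \<alpha> acts as A. Density gives exact equality here, without a limit.\<close>
      obtain s where s: "\<And>k. k \<le> max (J i) (J (Suc i)) \<Longrightarrow> solenoid_proj M s k = x k"
        using solenoid_proj_approx[OF x] by blast
      have "\<alpha> x (Suc i) = \<alpha> (solenoid_proj M s) (Suc i)" "\<alpha> x i = \<alpha> (solenoid_proj M s) i"
        by (simp_all add: \<alpha>_def s)
      then show "torus_map (M i) (\<alpha> x (Suc i)) = \<alpha> x i"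
        using solenoid_proj_in[of "A *v s"] by (simp add: proj solenoid_def)
    qed
  qed (rule proj)
qed

lemma endomorphisms_inverse:
  assumes \<alpha>: "\<And>s. \<alpha> (solenoid_proj M s) = solenoid_proj M (A *v s)"
      "\<And>i. \<exists>j. \<forall>x y. x j = y j \<longrightarrow> \<alpha> x i = \<alpha> y i"
    and \<beta>: "\<And>s. \<beta> (solenoid_proj M s) = solenoid_proj M (B *v s)"
      "\<And>i. \<exists>j. \<forall>x y. x j = y j \<longrightarrow> \<beta> x i = \<beta> y i"
    and AB: "A ** B = mat 1" and x: "x \<in> solenoid M"
  shows "\<alpha> (\<beta> x) = x"
proof
  fix i
  obtain j where j: "\<And>x y. x j = y j \<Longrightarrow> \<alpha> x i = \<alpha> y i" using \<alpha>(2) by metis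
  obtain k where k: "\<And>x y. x k = y k \<Longrightarrow> \<beta> x j = \<beta> y j" using \<beta>(2) by metis
  \<comment> \<open>Agreement at k controls the left-hand side, agreement at i the right-hand
    side.\<close>
  obtain s where s: "\<And>l. l \<le> max i k \<Longrightarrow> solenoid_proj M s l = x l"
    using solenoid_proj_approx[OF x] by blast
  have "\<beta> x j = \<beta> (solenoid_proj M s) j" by (intro k) (simp add: s)
  then have "\<alpha> (\<beta> x) i = \<alpha> (\<beta> (solenoid_proj M s)) i" by (rule j)
  also have "\<dots> = x i" by (simp add: \<alpha>(1) \<beta>(1) matrix_vector_mul_assoc AB s)
  finally show "\<alpha> (\<beta> x) i = x i" .
qed

lemma automorphism_of_matrix:
  assumes "integral_conjugates M A" "integral_conjugates M B" "A ** B = mat 1" "B ** A = mat 1"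
  obtains \<alpha> where "\<alpha> \<in> solenoid_aut M" "lift_matrix M \<alpha> A"
proof -
  obtain \<alpha> where \<alpha>: "continuous_on UNIV \<alpha>" "\<And>x y. \<alpha> (seq_add x y) = seq_add (\<alpha> x) (\<alpha> y)"
    "\<And>s. \<alpha> (solenoid_proj M s) = solenoid_proj M (A *v s)"
    "\<And>i. \<exists>j. \<forall>x y. x j = y j \<longrightarrow> \<alpha> x i = \<alpha> y i"
    "\<And>x. x \<in> solenoid M \<Longrightarrow> \<alpha> x \<in> solenoid M"
    by (rule integral_conjugates_endomorphism[OF assms(1)]) blast
  obtain \<beta> where \<beta>: "continuous_on UNIV \<beta>" "\<And>x y. \<beta> (seq_add x y) = seq_add (\<beta> x) (\<beta> y)"
    "\<And>s. \<beta> (solenoid_proj M s) = solenoid_proj M (B *v s)"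
    "\<And>i. \<exists>j. \<forall>x y. x j = y j \<longrightarrow> \<beta> x i = \<beta> y i"
    "\<And>x. x \<in> solenoid M \<Longrightarrow> \<beta> x \<in> solenoid M"
    by (rule integral_conjugates_endomorphism[OF assms(2)]) blast
  note inv = endomorphisms_inverse[OF \<alpha>(3,4) \<beta>(3,4) assms(3)] endomorphisms_inverse[OF \<beta>(3,4) \<alpha>(3,4) assms(4)]
  have "homeomorphism (solenoid M) (solenoid M) \<alpha> \<beta>"
    using \<alpha>(5) \<beta>(5) inv
    by (intro homeomorphismI continuous_on_subset[OF \<alpha>(1)] continuous_on_subset[OF \<beta>(1)]) auto
  moreover have "invertible A" using assms(3,4) unfolding invertible_def by blast
  ultimately show thesis
    using \<alpha>(2,3) by (intro that[of \<alpha>]) (auto simp: solenoid_aut_def lift_matrix_def)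
qed

lemma homeomorphism_asymptotics:
  assumes "homeomorphism (solenoid M) (solenoid M) h h'"
  obtains \<alpha> A where "\<alpha> \<in> solenoid_aut M" "lift_matrix M \<alpha> A" "linear_asymptotics M h A"
proof -
  obtain A where A: "linear_asymptotics M h A" "integral_conjugates M A"
    using solenoid_map_asymptotics[of h] assms by (auto simp: homeomorphism_def)
  obtain B where B: "linear_asymptotics M h' B" "integral_conjugates M B"
    using solenoid_map_asymptotics[of h'] assms by (auto simp: homeomorphism_def)
  have "B ** A = mat 1"
    using linear_asymptotics_left_inverse[OF A(1) B(1)] assms by (auto simp: homeomorphism_def)
  then show thesis
    using automorphism_of_matrix[OF A(2) B(2)] that A(1) matrix_left_right_inverse by metis
qed

end

section \<open>Convergence to points of the remainder\<close>

lemma norm_ball_embed_less: "norm (ball_embed x) < 1"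
proof -
  have "norm x < sqrt (1 + (norm x)\<^sup>2)" by (rule real_less_rsqrt) simp
  moreover have "0 < sqrt (1 + (norm x)\<^sup>2)" by (simp add: add_pos_nonneg)
  ultimately show ?thesis by (simp add: ball_embed_def divide_simps)
qed

lemma perspective_class_fst:
  assumes "p \<in> cball 0 1 \<times> fibre M" "perspective_class M p = perspective_class M q"
  shows "fst p = fst q"
proof -
  have "p \<in> perspective_class M p" using assms(1) by (simp add: perspective_class_def)
  then show ?thesis unfolding assms(2) by (auto simp: perspective_class_def)
qed

lemma topspace_perspective_compactification:
  "topspace (perspective_compactification M) = perspective_class M ` (cball 0 1 \<times> fibre M)"
proof -
  let ?D = "cball 0 1 \<times> fibre M" and ?q = "perspective_class M"
  have "{p \<in> ?D. ?q p \<in> ?q ` ?D} = ?D" by blast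
  then have "openin (perspective_compactification M) (?q ` ?D)"
    unfolding openin_perspective_compactification by simp
  moreover have "topspace (perspective_compactification M) \<subseteq> ?q ` ?D"
    using openin_topspace[of "perspective_compactification M"]
    unfolding openin_perspective_compactification by (rule conjunct1)
  ultimately show ?thesis by (simp add: openin_subset subset_antisym)
qed

text \<open>A lifted orbit keeps its fibre component, so it lives in one slice of the ball times the
  fibre, and no two points of a slice are identified. One direction uses that the first component is
  well defined on classes, the other that the quotient map is continuous.\<close>

lemma limitin_remainder_point_iff:
  assumes c: "c \<in> fibre M" and x: "norm x = 1"
  shows "limitin (perspective_compactification M) (\<lambda>i. perspective_embed M (a i, c)) (remainder_point M x) F
    \<longleftrightarrow> ((\<lambda>i. ball_embed (a i)) \<longlongrightarrow> x) F" (is "?L \<longleftrightarrow> ?R")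
proof
  let ?D = "cball 0 1 \<times> fibre M" and ?q = "perspective_class M"
  have rem: "remainder_point M x = ?q (x, c)" using x c by (simp add: perspective_class_remainder)
  have xD: "(x, c) \<in> ?D" using x c by simp
  have aD: "(ball_embed (a i), c) \<in> ?D" for i using norm_ball_embed_less[of "a i"] c by simp
  show ?R if ?L
  proof (rule topological_tendstoI)
    fix V assume V: "open V" "x \<in> V"
    let ?U = "?q ` {p \<in> ?D. fst p \<in> V}"
    have "{p \<in> ?D. ?q p \<in> ?U} = ?D \<inter> (V \<times> UNIV)"
      using perspective_class_fst[of _ M] by (auto simp del: mem_cball) blast+
    then have "openin (perspective_compactification M) ?U"
      unfolding openin_perspective_compactification
      using V by (auto intro!: openin_open_Int open_Times)
    moreover have "remainder_point M x \<in> ?U" unfolding rem using xD V by (intro imageI) simp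
    ultimately have "\<forall>\<^sub>F i in F. perspective_embed M (a i, c) \<in> ?U"
      using \<open>?L\<close> by (simp add: limitin_def)
    then show "\<forall>\<^sub>F i in F. ball_embed (a i) \<in> V"
    proof (rule eventually_mono)
      fix i assume "perspective_embed M (a i, c) \<in> ?U"
      then obtain p where p: "?q (ball_embed (a i), c) = ?q p" "fst p \<in> V"
        unfolding perspective_embed_def by auto
      show "ball_embed (a i) \<in> V" using perspective_class_fst[OF aD p(1)] p(2) by simp
    qed
  qed
  show ?L if ?R
    unfolding limitin_def topspace_perspective_compactification
  proof (intro conjI allI impI)
    show "remainder_point M x \<in> ?q ` ?D" unfolding rem using xD by (rule imageI)
    fix U assume U: "openin (perspective_compactification M) U \<and> remainder_point M x \<in> U"
    then obtain W where W: "open W" "{p \<in> ?D. ?q p \<in> U} = ?D \<inter> W"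
      by (auto simp: openin_perspective_compactification openin_open)
    have "(x, c) \<in> W" using W(2) xD U rem by auto
    moreover have "((\<lambda>i. (ball_embed (a i), c)) \<longlongrightarrow> (x, c)) F"
      using \<open>?R\<close> by (intro tendsto_Pair) auto
    ultimately have "\<forall>\<^sub>F i in F. (ball_embed (a i), c) \<in> W"
      using W(1) topological_tendstoD by blast
    then show "\<forall>\<^sub>F i in F. perspective_embed M (a i, c) \<in> U"
    proof (rule eventually_mono)
      fix i assume "(ball_embed (a i), c) \<in> W"
      then have "(ball_embed (a i), c) \<in> {p \<in> ?D. ?q p \<in> U}" unfolding W(2) using aD by blast
      then show "perspective_embed M (a i, c) \<in> U" by (simp add: perspective_embed_def)
    qed
  qed
qed

section \<open>Linear maps and bounded errors at infinity\<close>

lemma invertible_mult_nonzero: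
  fixes A :: "real ^ 'n ^ 'n"
  assumes "invertible A" "x \<noteq> 0"
  shows "A *v x \<noteq> 0"
  using invertible_matrix_inv_mult(5)[OF assms(1), of x] assms(2) by auto

lemma ball_embed_limit_linear:
  fixes A :: "real ^ 'n ^ 'n"
  assumes lim: "((\<lambda>i. ball_embed (a i)) \<longlongrightarrow> x) F" and x: "norm x = 1"
    and bdd: "bounded (range (\<lambda>i. b i - A *v a i))" and A: "invertible A"
  shows "((\<lambda>i. ball_embed (b i)) \<longlongrightarrow> sphere_map A x) F"
proof -
  define r where "r i = sqrt (1 + (norm (a i))\<^sup>2)" for i
  have r_pos: "r i > 0" for i by (simp add: r_def add_pos_nonneg)
  have r_sq: "(r i)\<^sup>2 = 1 + (norm (a i))\<^sup>2" for i by (simp add: r_def)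
  have nz: "A *v x \<noteq> 0" using invertible_mult_nonzero[OF A, of x] x by fastforce
  \<comment> \<open>This identity shows that approaching the sphere forces r to infinity; division
    by r then removes the bounded error b - A a.\<close>
  have "(inverse (r i))\<^sup>2 = 1 - (norm (ball_embed (a i)))\<^sup>2" for i
  proof -
    have "(norm (ball_embed (a i)))\<^sup>2 = (norm (a i))\<^sup>2 / (r i)\<^sup>2"
      using r_pos[of i] by (simp add: ball_embed_def power_mult_distrib divide_inverse power_inverse flip: r_def)
    also have "\<dots> = ((r i)\<^sup>2 - 1) / (r i)\<^sup>2" by (simp add: r_sq)
    also have "\<dots> = 1 - (inverse (r i))\<^sup>2"
      using r_pos[of i] by (simp add: diff_divide_distrib power_divide inverse_eq_divide)
    finally show ?thesis by simp
  qed
  moreover have "((\<lambda>i. 1 - (norm (ball_embed (a i)))\<^sup>2) \<longlongrightarrow> 1 - (norm x)\<^sup>2) F"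
    by (intro tendsto_intros lim)
  ultimately have r0: "((\<lambda>i. (inverse (r i))\<^sup>2) \<longlongrightarrow> 0) F" using x by simp
  then have "((\<lambda>i. sqrt ((inverse (r i))\<^sup>2)) \<longlongrightarrow> sqrt 0) F" by (intro tendsto_real_sqrt)
  then have inv_r: "((\<lambda>i. inverse (r i)) \<longlongrightarrow> 0) F"
    using r_pos by (simp add: less_imp_le)
  obtain K where "\<And>i. norm (b i - A *v a i) \<le> K" using bdd by (auto simp: bounded_iff)
  then have "Bfun (\<lambda>i. b i - A *v a i) F" by (intro BfunI[where K = K]) simp
  then have "((\<lambda>i. inverse (r i) *\<^sub>R (b i - A *v a i)) \<longlongrightarrow> 0) F"
    using bounded_bilinear.Zfun_prod_Bfun[OF bounded_bilinear_scaleR] inv_r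
    by (simp add: tendsto_Zfun_iff)
  moreover have "((\<lambda>i. A *v ball_embed (a i)) \<longlongrightarrow> A *v x) F"
    by (rule bounded_linear.tendsto[OF matrix_vector_mul_bounded_linear lim])
  ultimately have "((\<lambda>i. A *v ball_embed (a i) + inverse (r i) *\<^sub>R (b i - A *v a i)) \<longlongrightarrow> A *v x + 0) F"
    by (intro tendsto_add)
  moreover have "A *v ball_embed (a i) + inverse (r i) *\<^sub>R (b i - A *v a i) = inverse (r i) *\<^sub>R b i" for i
    by (simp add: ball_embed_def r_def matrix_vector_mult_scaleR scaleR_diff_right)
  ultimately have br: "((\<lambda>i. inverse (r i) *\<^sub>R b i) \<longlongrightarrow> A *v x) F" by simp
  \<comment> \<open>\<open>ball_embed\<close> of b is rewritten in terms of b / r and 1 / r, whose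
    limits are known; the denominator tends to the norm of A x, which is not 0.\<close>
  have "((\<lambda>i. (inverse (r i) *\<^sub>R b i) /\<^sub>R sqrt ((inverse (r i))\<^sup>2 + (norm (inverse (r i) *\<^sub>R b i))\<^sup>2))
      \<longlongrightarrow> (A *v x) /\<^sub>R sqrt (0 + (norm (A *v x))\<^sup>2)) F"
    using nz by (intro tendsto_intros r0 br) simp
  moreover have "(inverse (r i) *\<^sub>R b i) /\<^sub>R sqrt ((inverse (r i))\<^sup>2 + (norm (inverse (r i) *\<^sub>R b i))\<^sup>2)
      = ball_embed (b i)" for i
  proof -
    have "(inverse (r i))\<^sup>2 + (norm (inverse (r i) *\<^sub>R b i))\<^sup>2 = (inverse (r i))\<^sup>2 * (1 + (norm (b i))\<^sup>2)"
      using r_pos[of i] by (simp add: power_mult_distrib distrib_left)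
    then have "sqrt ((inverse (r i))\<^sup>2 + (norm (inverse (r i) *\<^sub>R b i))\<^sup>2)
        = inverse (r i) * sqrt (1 + (norm (b i))\<^sup>2)"
      using r_pos[of i] by (simp add: real_sqrt_mult)
    then show ?thesis using r_pos[of i] by (simp add: ball_embed_def)
  qed
  ultimately show ?thesis by (simp add: sphere_map_def)
qed

lemma norm_sphere_map:
  fixes A :: "real ^ 'n ^ 'n"
  assumes "invertible A" "norm x = 1"
  shows "norm (sphere_map A x) = 1"
proof -
  have "A *v x \<noteq> 0" using invertible_mult_nonzero[OF assms(1), of x] assms(2) by fastforce
  then show ?thesis by (simp add: sphere_map_def)
qed

lemma sphere_map_mult:
  fixes A B :: "real ^ 'n ^ 'n"
  assumes "B *v x \<noteq> 0"
  shows "sphere_map A (sphere_map B x) = sphere_map (A ** B) x"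
  using assms by (simp add: sphere_map_def matrix_vector_mult_scaleR flip: matrix_vector_mul_assoc)

text \<open>This is where orientation enters: a decreasing change of time would send the times of
  approach to minus infinity.\<close>

lemma strict_mono_homeomorphism_at_top:
  fixes \<tau> :: "real \<Rightarrow> real"
  assumes "homeomorphism UNIV UNIV \<tau> \<tau>'" "strict_mono \<tau>"
  shows "filterlim \<tau> at_top at_top"
  unfolding filterlim_at_top
proof
  fix Z
  have "\<tau> (\<tau>' Z) = Z" using assms(1) by (simp add: homeomorphism_def)
  then have "Z \<le> \<tau> t" if "t \<ge> \<tau>' Z" for t
    using strict_mono_less_eq[OF assms(2), of "\<tau>' Z" t] that by simp
  then show "\<forall>\<^sub>F t in at_top. Z \<le> \<tau> t" using eventually_at_top_linorder by blast
qed

section \<open>Group operations on automorphisms\<close>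

lemma solenoid_aut_compose:
  assumes "\<alpha> \<in> solenoid_aut M" "\<beta> \<in> solenoid_aut M"
  shows "\<alpha> \<circ> \<beta> \<in> solenoid_aut M"
proof -
  obtain \<alpha>' \<beta>' where hom: "homeomorphism (solenoid M) (solenoid M) \<alpha> \<alpha>'"
    "homeomorphism (solenoid M) (solenoid M) \<beta> \<beta>'"
    using assms by (auto simp: solenoid_aut_def)
  have "\<beta> x \<in> solenoid M" if "x \<in> solenoid M" for x
    using hom(2) that by (auto simp: homeomorphism_def)
  then show ?thesis
    using assms homeomorphism_compose[OF hom(2,1)] by (auto simp: solenoid_aut_def)
qed

lemma solenoid_aut_inverse:
  assumes \<alpha>: "\<alpha> \<in> solenoid_aut M" and hom: "homeomorphism (solenoid M) (solenoid M) \<alpha> \<beta>"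
  shows "\<beta> \<in> solenoid_aut M"
proof -
  have \<beta>: "\<beta> x \<in> solenoid M" "\<alpha> (\<beta> x) = x" "\<beta> (\<alpha> x) = x" if "x \<in> solenoid M" for x
    using hom that by (auto simp: homeomorphism_def)
  have "\<beta> (seq_add x y) = seq_add (\<beta> x) (\<beta> y)" if "x \<in> solenoid M" "y \<in> solenoid M" for x y
  proof -
    have "\<alpha> (seq_add (\<beta> x) (\<beta> y)) = seq_add (\<alpha> (\<beta> x)) (\<alpha> (\<beta> y))"
      using \<alpha> \<beta> that by (simp add: solenoid_aut_def)
    then show ?thesis using \<beta> that seq_add_in_solenoid by metis
  qed
  moreover have "homeomorphism (solenoid M) (solenoid M) \<beta> \<alpha>" by (rule homeomorphism_symD[OF hom])
  ultimately show ?thesis by (auto simp: solenoid_aut_def)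
qed

section \<open>Transport of points of perspective and rotation classes\<close>

context nonsingular_sequence
begin

lemma lift_matrix_inverse:
  assumes lift: "lift_matrix M \<alpha> A" and hom: "homeomorphism (solenoid M) (solenoid M) \<alpha> \<beta>"
  shows "lift_matrix M \<beta> (matrix_inv A)"
proof -
  have A: "invertible A" and \<alpha>: "\<And>s. solenoid_proj M (A *v s) = \<alpha> (solenoid_proj M s)"
    using lift by (auto simp: lift_matrix_def)
  have "solenoid_proj M (matrix_inv A *v s) = \<beta> (solenoid_proj M s)" for s
  proof -
    have "solenoid_proj M s = \<alpha> (solenoid_proj M (matrix_inv A *v s))"
      by (simp add: invertible_matrix_inv_mult A flip: \<alpha>)
    then show ?thesis using hom solenoid_proj_in by (simp add: homeomorphism_def)
  qed
  then show ?thesis using invertible_matrix_inv_mult(3)[OF A] by (simp add: lift_matrix_def)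
qed

lemma points_of_perspective_sphere_map:
  assumes hom: "homeomorphism (solenoid M) (solenoid M) h h'"
    and asymp: "linear_asymptotics M h A" and A: "invertible A"
    and orient: "\<And>y. y \<in> solenoid M \<Longrightarrow> orientation_preserving_at \<phi> \<psi> h y"
    and x: "x \<in> points_of_perspective M \<phi>"
  shows "sphere_map A x \<in> points_of_perspective M \<psi>"
proof -
  have norm_x: "norm x = 1" using x by (simp add: points_of_perspective_def)
  obtain y L t where y: "y \<in> solenoid M" and L: "continuous_on UNIV L" "range L \<subseteq> UNIV \<times> fibre M"
      "\<And>s. cover M (L s) = \<phi> s y"
    and t: "filterlim t at_top sequentially"
      "limitin (perspective_compactification M) (\<lambda>i. perspective_embed M (L (t i)))
        (remainder_point M x) sequentially"
    using x unfolding points_of_perspective_def by blast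
  define a c where "a = fst \<circ> L" and "c = snd (L 0)"
  have "continuous_on UNIV (\<lambda>s. snd (L s))" by (intro continuous_on_snd L)
  moreover have snd_L: "snd (L s) \<in> fibre M" for s using subsetD[OF L(2) rangeI[of L s]] by (simp add: mem_Times_iff)
  ultimately have "snd (L s) = c" for s
    unfolding c_def by (rule fibre_valued_continuous_constant)
  then have L_eq: "L s = (a s, c)" for s by (simp add: a_def prod_eq_iff)
  have c: "c \<in> fibre M" by (simp add: c_def snd_L)
  have cont_a: "continuous_on UNIV a" unfolding a_def comp_def by (intro continuous_on_fst L)
  have lim: "(\<lambda>i. ball_embed (a (t i))) \<longlonglongrightarrow> x"
    using t(2) unfolding L_eq limitin_remainder_point_iff[OF c norm_x] .
  obtain G c' where G: "c' \<in> fibre M" "continuous_on UNIV G"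
      "\<And>s. h (cover M (s, c)) = cover M (G s, c')" "bounded (range (\<lambda>s. G s - A *v s))"
    using asymp[unfolded linear_asymptotics_def, rule_format, OF c] by auto
  obtain \<tau> \<tau>' where \<tau>: "homeomorphism UNIV UNIV \<tau> \<tau>'" "strict_mono \<tau>" "\<And>t. h (\<phi> t y) = \<psi> (\<tau> t) (h y)"
    using orient[OF y] by (auto simp: orientation_preserving_at_def)
  have \<tau>': "\<tau> (\<tau>' s) = s" "\<tau>' (\<tau> s) = s" "continuous_on UNIV \<tau>'" for s
    using \<tau>(1) by (simp_all add: homeomorphism_def)
  \<comment> \<open>Running through the image of L with \<tau>' makes it a lift of the \<psi>-orbit
    of h y with the right time; at the times \<tau> (t i) its first component is G (a (t
    i)).\<close>
  define L' where "L' s = (G (a (\<tau>' s)), c')" for s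
  have "h y \<in> solenoid M" using hom y by (auto simp: homeomorphism_def)
  moreover have "continuous_on UNIV L'"
    unfolding L'_def
    by (intro continuous_on_Pair continuous_on_const continuous_on_compose2[OF G(2)]
        continuous_on_compose2[OF cont_a] \<tau>') auto
  moreover have "range L' \<subseteq> UNIV \<times> fibre M" using G(1) by (auto simp: L'_def)
  moreover have "cover M (L' s) = \<psi> s (h y)" for s
  proof -
    have "cover M (L' s) = h (\<phi> (\<tau>' s) y)" by (simp add: L'_def L_eq flip: G(3) L(3))
    then show ?thesis by (simp add: \<tau> \<tau>')
  qed
  moreover have "filterlim (\<lambda>i. \<tau> (t i)) at_top sequentially"
    by (rule filterlim_compose[OF strict_mono_homeomorphism_at_top[OF \<tau>(1,2)] t(1)])
  moreover have "limitin (perspective_compactification M) (\<lambda>i. perspective_embed M (L' (\<tau> (t i))))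
      (remainder_point M (sphere_map A x)) sequentially"
  proof -
    have "bounded (range (\<lambda>i. G (a (t i)) - A *v a (t i)))"
      by (rule bounded_subset[OF G(4)]) auto
    from ball_embed_limit_linear[OF lim norm_x this A]
    show ?thesis
      unfolding L'_def \<tau>' limitin_remainder_point_iff[OF G(1) norm_sphere_map[OF A norm_x]] .
  qed
  ultimately show ?thesis
    using norm_sphere_map[OF A norm_x] unfolding points_of_perspective_def by auto
qed

text \<open>By saturation the automorphism attached to h can be absorbed: C x is the image of A x
  under C times the inverse of A, and that product again belongs to an automorphism.\<close>

lemma rotation_class_subset:
  assumes hom: "homeomorphism (solenoid M) (solenoid M) h h'"
    and orient: "\<And>y. y \<in> solenoid M \<Longrightarrow> orientation_preserving_at \<phi> \<psi> h y"
  shows "rotation_class M \<phi> \<subseteq> rotation_class M \<psi>"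
proof
  fix z assume "z \<in> rotation_class M \<phi>"
  then obtain \<gamma> C x where C: "\<gamma> \<in> solenoid_aut M" "lift_matrix M \<gamma> C"
    and x: "x \<in> points_of_perspective M \<phi>" and z: "z = sphere_map C x"
    unfolding rotation_class_def aut_saturation_def by blast
  obtain \<alpha> A where A: "\<alpha> \<in> solenoid_aut M" "lift_matrix M \<alpha> A" "linear_asymptotics M h A"
    by (rule homeomorphism_asymptotics[OF hom])
  have inv: "invertible A" using A(2) by (simp add: lift_matrix_def)
  obtain \<beta> where \<beta>: "homeomorphism (solenoid M) (solenoid M) \<alpha> \<beta>"
    using A(1) by (auto simp: solenoid_aut_def)
  let ?B = "matrix_inv A"
  have "\<gamma> \<circ> \<beta> \<in> solenoid_aut M"
    by (intro solenoid_aut_compose C solenoid_aut_inverse[OF A(1) \<beta>])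
  moreover have "lift_matrix M (\<gamma> \<circ> \<beta>) (C ** ?B)"
    using C(2) lift_matrix_inverse[OF A(2) \<beta>]
    by (auto simp: lift_matrix_def invertible_mult simp flip: matrix_vector_mul_assoc)
  moreover have "z = sphere_map (C ** ?B) (sphere_map A x)"
  proof -
    have "norm x = 1" using x by (simp add: points_of_perspective_def)
    then have "A *v x \<noteq> 0" using invertible_mult_nonzero[OF inv, of x] by fastforce
    then show ?thesis
      by (simp add: sphere_map_mult z invertible_matrix_inv_mult inv flip: matrix_mul_assoc)
  qed
  moreover have "sphere_map A x \<in> points_of_perspective M \<psi>"
    by (rule points_of_perspective_sphere_map[OF hom A(3) inv orient x])
  ultimately show "z \<in> rotation_class M \<psi>"
    unfolding rotation_class_def aut_saturation_def by blast
qed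

end

text \<open>Makes the inclusion of rotation classes applicable to the inverse equivalence, so that
  equality follows by symmetry. Invariance of X under \<phi> allows h' to cancel h along the
  orbit.\<close>

lemma orientation_preserving_at_inverse:
  assumes hom: "homeomorphism X Y h h'" and \<phi>: "\<And>t x. x \<in> X \<Longrightarrow> \<phi> t x \<in> X"
    and orient: "\<And>x. x \<in> X \<Longrightarrow> orientation_preserving_at \<phi> \<psi> h x" and y: "y \<in> Y"
  shows "orientation_preserving_at \<psi> \<phi> h' y"
proof -
  have x: "h' y \<in> X" "h (h' y) = y" using hom y by (auto simp: homeomorphism_def)
  obtain \<tau> \<tau>' where \<tau>: "homeomorphism UNIV UNIV \<tau> \<tau>'" "strict_mono \<tau>" "\<And>t. h (\<phi> t (h' y)) = \<psi> (\<tau> t) y"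
    using orient[OF x(1)] x(2) by (auto simp: orientation_preserving_at_def)
  have inv: "\<tau> (\<tau>' t) = t" for t using \<tau>(1) by (simp add: homeomorphism_def)
  have "strict_mono \<tau>'"
    using strict_mono_less[OF \<tau>(2)] inv by (intro strict_monoI) metis
  moreover have "h' (\<psi> t y) = \<phi> (\<tau>' t) (h' y)" for t
  proof -
    have "h (\<phi> (\<tau>' t) (h' y)) = \<psi> t y" by (simp add: \<tau>(3) inv)
    then show ?thesis using hom \<phi>[OF x(1)] by (metis homeomorphism_apply1)
  qed
  ultimately show ?thesis
    using homeomorphism_symD[OF \<tau>(1)] unfolding orientation_preserving_at_def by blast
qed

theorem theorem7:
  fixes M :: "nat \<Rightarrow> int ^ 'n ^ 'n"
    and \<phi> \<psi> :: "real \<Rightarrow> (nat \<Rightarrow> 'n torus) \<Rightarrow> (nat \<Rightarrow> 'n torus)"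
  assumes "CARD('n) \<ge> 2"
    and "\<And>j. det (M j) \<noteq> 0"
    and "flow_on (solenoid M) \<phi>"
    and "flow_on (solenoid M) \<psi>"
    and "top_equivalent (solenoid M) \<phi> (solenoid M) \<psi>"
  shows "rotation_class M \<phi> = rotation_class M \<psi>"
proof -
  interpret nonsingular_sequence M by unfold_locales (rule assms(2))
  obtain h h' where hom: "homeomorphism (solenoid M) (solenoid M) h h'"
    and orient: "\<And>x. x \<in> solenoid M \<Longrightarrow> orientation_preserving_at \<phi> \<psi> h x"
    using assms(5) unfolding top_equivalent_def by blast
  have flow: "\<And>t x. x \<in> solenoid M \<Longrightarrow> \<phi> t x \<in> solenoid M"
    using assms(3) by (simp add: flow_on_def)
  have hom': "homeomorphism (solenoid M) (solenoid M) h' h" by (rule homeomorphism_symD[OF hom])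
  show ?thesis
    using rotation_class_subset[OF hom orient]
      rotation_class_subset[OF hom' orientation_preserving_at_inverse[OF hom flow orient]]
    by blast
qed

end
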